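(* Let $d=d(n)\ge 1$ and $\Delta=\Delta(n)>1$ be integers (possibly depending on the positive integer $n$), and let $p=p(n)\in[0,1]$ satisfy $p=\omega\left(\Delta^{12}\,n^{-1/d}\log^3 n\right)$. Then a random graph $G\sim\mathcal G(n,p)$ is with high probability $\mathcal H(n,\Delta,d,7)$-universal, i.e. the probability that $G$ simultaneously contains a copy of every graph $H\in\mathcal H(n,\Delta,d,7)$ tends to $1$ as $n\to\infty$.
   Context: All graphs are finite and simple. $\mathcal G(n,p)$ is the random graph on $n$ vertices in which each pair of vertices forms an edge independently with probability $p$. The maximum density of a graph $G$ is $d(G)=\max\{2|E(H)|/|V(H)| : H\subseteq G\}$, the maximum being over subgraphs $H$ with at least one vertex. $\mathcal H(n,\Delta,d,g)$ is the family of all graphs on $n$ vertices with maximum degree at most $\Delta$, maximum density at most $d$, and girth at least $g$ (the girth is the length of a shortest cycle, and is $\infty$ for acyclic graphs). A graph $G$ is universal for a family $\mathcal H$ ($\mathcal H$-universal) if for every $H\in\mathcal H$ it contains a (not necessarily induced) subgraph isomorphic to $H$. "With high probability" means with probability tending to $1$ as $n\to\infty$; $f=\omega(g)$ means $f(n)/g(n)\to\infty$ as $n\to\infty$; $\log$ is the natural logarithm. *)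

theory Defs
  imports "HOL-Probability.Probability" "HOL-Library.Ramsey"
begin

type_synonym 'a graph = "'a set \<times> 'a set set"

abbreviation verts :: "'a graph \<Rightarrow> 'a set" where
  "verts \<equiv> fst"

abbreviation edges :: "'a graph \<Rightarrow> 'a set set" where
  "edges \<equiv> snd"

text \<open>Edges are two-element sets of vertices, so loops, multiple edges and directions are excluded.\<close>

definition simple_graph :: "'a graph \<Rightarrow> bool" where
  "simple_graph G \<longleftrightarrow> finite (verts G) \<and> edges G \<subseteq> [verts G]\<^bsup>2\<^esup>"

definition subgraph :: "'a graph \<Rightarrow> 'a graph \<Rightarrow> bool" where
  "subgraph H G \<longleftrightarrow> simple_graph H \<and> verts H \<subseteq> verts G \<and> edges H \<subseteq> edges G"

definition isomorphic :: "'a graph \<Rightarrow> 'b graph \<Rightarrow> bool" where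
  "isomorphic G H \<longleftrightarrow>
     (\<exists>f. bij_betw f (verts G) (verts H) \<and> edges H = (\<lambda>e. f ` e) ` edges G)"

definition degree :: "'a graph \<Rightarrow> 'a \<Rightarrow> nat" where
  "degree G v = card {e \<in> edges G. v \<in> e}"

text \<open>The maximum degree and the maximum density are only meaningful for graphs with at least one
  vertex (otherwise they are \<open>Max\<close> of the empty set).\<close>

definition max_degree :: "'a graph \<Rightarrow> nat" where
  "max_degree G = Max (degree G ` verts G)"

definition max_density :: "'a graph \<Rightarrow> real" where
  "max_density G =
     Max {2 * real (card (edges H)) / real (card (verts H)) | H. subgraph H G \<and> verts H \<noteq> {}}"

text \<open>A cycle is given by the list of its vertices in cyclic order, without repeating the first one.\<close>

definition cycle :: "'a graph \<Rightarrow> 'a list \<Rightarrow> bool" where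
  "cycle G c \<longleftrightarrow> length c \<ge> 3 \<and> distinct c \<and>
     (\<forall>i<length c. {c ! i, c ! (Suc i mod length c)} \<in> edges G)"

text \<open>The infimum of the empty set in \<open>enat\<close> is infinity, as required for acyclic graphs.\<close>

definition girth :: "'a graph \<Rightarrow> enat" where
  "girth G = (INF c \<in> {c. cycle G c}. enat (length c))"

text \<open>Every finite graph has an isomorphic copy on natural numbers, so taking vertices of type
  \<open>nat\<close> loses nothing.\<close>

definition graph_family :: "nat \<Rightarrow> nat \<Rightarrow> real \<Rightarrow> enat \<Rightarrow> nat graph set" where
  "graph_family n \<Delta> d g =
     {H. simple_graph H \<and> card (verts H) = n \<and>
         max_degree H \<le> \<Delta> \<and> max_density H \<le> d \<and> girth H \<ge> g}"

definition universal :: "'a graph \<Rightarrow> 'b graph set \<Rightarrow> bool" where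
  "universal G \<H> \<longleftrightarrow> (\<forall>H\<in>\<H>. \<exists>H'. subgraph H' G \<and> isomorphic H H')"

text \<open>One independent Bernoulli variable for each pair of vertices in \<open>{..<n}\<close>; the pairs
  for which it is true are the edges.\<close>

definition random_graph :: "nat \<Rightarrow> real \<Rightarrow> nat graph pmf" where
  "random_graph n p =
     map_pmf (\<lambda>b. ({..<n}, {e \<in> [{..<n}]\<^bsup>2\<^esup>. b e}))
       (Pi_pmf ([{..<n}]\<^bsup>2\<^esup>) False (\<lambda>_. bernoulli_pmf p))"

end

theory Submission
  imports Defs
begin

text \<open>
  Let \<open>q = p ^ d\<close>. A set \<open>W\<close> of about \<open>n / (d\<^sup>2 \<Delta>\<^sup>6)\<close> vertices of \<open>H\<close> of one common degree \<open>k \<le> d\<close>, pairwise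
  at distance at least 7, is embedded last, and its neighbourhood \<open>N(W)\<close> is embedded first, onto
  fixed blocks of size \<open>k\<close>. Since the average degree of every subgraph is at most \<open>d\<close> and the girth
  is at least 7, the remaining vertices can be peeled off in \<open>O(d \<Delta>\<^sup>2 log n)\<close> stages such that every
  stage is 2-independent and each of its vertices has at most \<open>d\<close> neighbours in \<open>N(W)\<close> and
  the earlier stages. Each stage, and finally \<open>W\<close>, is embedded by Hall's theorem: its vertices
  need common neighbours of disjoint vertex sets of size at most \<open>d\<close>. Hall's condition
  follows from expansion properties that hold simultaneously for all possible histories of the
  embedding: two large families are never completely unjoined, small families expand into a reserve
  set kept free for the stage, and small sets of leftover vertices see almost all of the fixed
  blocks. A pair of a family of \<open>x\<close> disjoint sets and a set of \<open>y\<close> vertices violates this with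
  probability at most \<open>exp (- q x y)\<close>, which beats the union bound once \<open>q\<close> times the size of the
  reserve sets is a large multiple of \<open>d log n\<close>.
\<close>

subsection \<open>Matchings and separated sets\<close>

text \<open>Rado's argument: while some \<open>A i\<close> has two elements, one of any two of them
  can be deleted without spoiling Hall's condition. Once all sets are singletons, the condition for
  pairs makes them distinct. The induction is on the total size of the sets.\<close>

lemma hall_marriage:
  fixes A :: "'i \<Rightarrow> 'a set"
  assumes "finite I" "\<And>i. i \<in> I \<Longrightarrow> finite (A i)"
    and "\<And>J. J \<subseteq> I \<Longrightarrow> card J \<le> card (\<Union>(A ` J))"
  shows "\<exists>R. inj_on R I \<and> (\<forall>i\<in>I. R i \<in> A i)"
  using assms
proof (induction "\<Sum>i\<in>I. card (A i)" arbitrary: A rule: less_induct)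
  case less
  note finA = less.prems(2) and hall = less.prems(3)
  have card_pos: "card (A i) \<ge> 1" if "i \<in> I" for i
    using hall[of "{i}"] that by simp
  show ?case
  proof (cases "\<exists>i\<in>I. card (A i) \<ge> 2")
    case False
    then have "card (A i) = 1" if "i \<in> I" for i
      using card_pos[OF that] that by force
    then have "\<forall>i\<in>I. \<exists>x. A i = {x}"
      by (simp add: card_1_singleton_iff)
    then obtain R where R: "\<And>i. i \<in> I \<Longrightarrow> A i = {R i}" by metis
    have "inj_on R I"
    proof (rule inj_onI, rule ccontr)
      fix i j assume ij: "i \<in> I" "j \<in> I" "R i = R j" "i \<noteq> j"
      then show False using hall[of "{i, j}"] R by simp
    qed
    then show ?thesis using R by auto
  next
    case True
    then obtain i where i: "i \<in> I" "card (A i) \<ge> 2" by blast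
    then obtain x y where xy: "x \<in> A i" "y \<in> A i" "x \<noteq> y"
      using card_le_Suc0_iff_eq[OF finA[OF i(1)]] by force
    define Hall where "Hall B \<longleftrightarrow> (\<forall>J\<subseteq>I. card J \<le> card (\<Union>(B ` J)))" for B :: "'i \<Rightarrow> 'a set"
    \<comment> \<open>A violator after the deletion of \<open>z\<close> has to contain
      \<open>i\<close>. Taking \<open>i\<close> out of it lowers its size by one and weakens the
      strict inequality.\<close>
    have viol: "\<exists>P \<subseteq> I - {i}. card (\<Union>(A ` P) \<union> (A i - {z})) \<le> card P"
      if nh: "\<not> Hall (A(i := A i - {z}))" for z
    proof -
      obtain J where J: "J \<subseteq> I" "card J > card (\<Union>((A(i := A i - {z})) ` J))"
        using nh unfolding Hall_def by (meson not_le)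
      have "i \<in> J"
      proof (rule ccontr)
        assume "i \<notin> J"
        then have "(A(i := A i - {z})) ` J = A ` J" by auto
        then show False using J hall[of J] by simp
      qed
      have "finite J" using J(1) less.prems(1) finite_subset by blast
      have eq: "\<Union>((A(i := A i - {z})) ` J) = \<Union>(A ` (J - {i})) \<union> (A i - {z})"
        using \<open>i \<in> J\<close> by (auto split: if_splits)
      have "card J = Suc (card (J - {i}))"
        using \<open>i \<in> J\<close> \<open>finite J\<close> by (rule card.remove[rotated])
      then have "card (\<Union>(A ` (J - {i})) \<union> (A i - {z})) \<le> card (J - {i})"
        using J(2) unfolding eq by linarith
      then show ?thesis
        using Diff_mono[OF J(1) order.refl] by (intro exI[of _ "J - {i}"] conjI)
    qed
    \<comment> \<open>If both deletions failed, \<open>?X\<close> and \<open>?Y\<close> would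
      together cover the sets of \<open>insert i (P \<union> Q)\<close>, since \<open>y\<close>
      survives in \<open>?X\<close> and \<open>x\<close> in \<open>?Y\<close>, while
      \<open>?X \<inter> ?Y\<close> contains those of \<open>P \<inter> Q\<close>. Then
      \<open>card ?X + card ?Y\<close> exceeds \<open>card P + card Q\<close>.\<close>
    have "Hall (A(i := A i - {x})) \<or> Hall (A(i := A i - {y}))"
    proof (rule ccontr)
      assume "\<not> ?thesis"
      then obtain P Q where P: "P \<subseteq> I - {i}" "card (\<Union>(A ` P) \<union> (A i - {x})) \<le> card P"
        and Q: "Q \<subseteq> I - {i}" "card (\<Union>(A ` Q) \<union> (A i - {y})) \<le> card Q"
        using viol[of x] viol[of y] by blast
      let ?X = "\<Union>(A ` P) \<union> (A i - {x})" and ?Y = "\<Union>(A ` Q) \<union> (A i - {y})"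
      have fin: "finite P" "finite Q" "finite ?X" "finite ?Y"
        using P(1) Q(1) i(1) less.prems(1) finA
        by (auto intro: finite_subset intro!: finite_UN_I)
      have "card (insert i (P \<union> Q)) \<le> card (\<Union>(A ` (insert i (P \<union> Q))))"
        using P(1) Q(1) i(1) by (intro hall) auto
      also have "\<Union>(A ` (insert i (P \<union> Q))) = ?X \<union> ?Y" using xy by auto
      finally have 1: "Suc (card (P \<union> Q)) \<le> card (?X \<union> ?Y)"
        using fin P(1) Q(1) by (subst (asm) card_insert_disjoint) auto
      have "card (P \<inter> Q) \<le> card (\<Union>(A ` (P \<inter> Q)))"
        using P(1) by (intro hall) auto
      also have "\<dots> \<le> card (?X \<inter> ?Y)"
        using fin by (intro card_mono) auto
      finally have 2: "card (P \<inter> Q) \<le> card (?X \<inter> ?Y)" .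
      show False
        using 1 2 P(2) Q(2) card_Un_Int[OF fin(1,2)] card_Un_Int[OF fin(3,4)] by linarith
    qed
    then obtain z where z: "z \<in> A i" "Hall (A(i := A i - {z}))" using xy by blast
    let ?B = "A(i := A i - {z})"
    have "\<exists>R. inj_on R I \<and> (\<forall>i\<in>I. R i \<in> ?B i)"
    proof (rule less.hyps)
      show "(\<Sum>j\<in>I. card (?B j)) < (\<Sum>j\<in>I. card (A j))"
      proof (rule sum_strict_mono_ex1)
        show "\<forall>j\<in>I. card (?B j) \<le> card (A j)"
          by (auto intro: card_mono finA)
        show "\<exists>j\<in>I. card (?B j) < card (A j)"
          using card_Diff1_less[OF finA[OF i(1)] z(1)] i(1) by (intro bexI[of _ i]) simp_all
      qed (use less.prems in auto)
    next
      show "finite (?B j)" if "j \<in> I" for j using finA[OF that] by auto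
    qed (use less.prems z in \<open>auto simp: Hall_def\<close>)
    then obtain R where R: "inj_on R I" "\<And>j. j \<in> I \<Longrightarrow> R j \<in> ?B j" by blast
    have "R j \<in> A j" if "j \<in> I" for j
      using R(2)[OF that] by (simp split: if_splits)
    then show ?thesis using R(1) by blast
  qed
qed

text \<open>Greedy choice: pick a vertex of \<open>S\<close>, discard its set \<open>B v\<close>,
  and continue. Each pick costs at most \<open>k\<close> vertices.\<close>

lemma separated_subset:
  fixes B :: "'a \<Rightarrow> 'a set"
  assumes "finite S" and refl: "\<And>v. v \<in> B v" and sym: "\<And>u v. u \<in> B v \<Longrightarrow> v \<in> B u"
    and "\<And>v. finite (B v)" "\<And>v. card (B v) \<le> k"
  shows "\<exists>I\<subseteq>S. (\<forall>u\<in>I. \<forall>v\<in>I. u \<noteq> v \<longrightarrow> u \<notin> B v) \<and> card S \<le> k * card I"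
  using assms(1)
proof (induction S rule: finite_psubset_induct)
  case (psubset S)
  show ?case
  proof (cases "S = {}")
    case False
    then obtain v where v: "v \<in> S" by blast
    then have "S - B v \<subset> S" using refl by auto
    from psubset.IH[OF this] obtain I
      where I: "I \<subseteq> S - B v" "\<forall>u\<in>I. \<forall>v\<in>I. u \<noteq> v \<longrightarrow> u \<notin> B v"
        "card (S - B v) \<le> k * card I" by blast
    have "finite I" using I(1) psubset.hyps finite_subset by blast
    have "v \<notin> I" using I(1) refl by auto
    have "card S \<le> card ((S - B v) \<union> B v)"
      using assms(4) psubset.hyps by (intro card_mono) auto
    also have "\<dots> \<le> card (S - B v) + card (B v)"
      by (rule card_Un_le)
    also have "\<dots> \<le> k * card I + k" using I(3) assms(5) add_mono by blast
    finally have "card S \<le> k * card (insert v I)"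
      using \<open>finite I\<close> \<open>v \<notin> I\<close> by simp
    moreover have "u \<notin> B v" "v \<notin> B u" if "u \<in> I" for u
      using that I(1) sym by blast+
    then have "\<forall>u\<in>insert v I. \<forall>w\<in>insert v I. u \<noteq> w \<longrightarrow> u \<notin> B w"
      using I(2) by blast
    moreover have "insert v I \<subseteq> S" using I(1) v by blast
    ultimately show ?thesis by blast
  qed auto
qed

subsection \<open>Decomposition of sparse graphs of girth at least 7\<close>

primrec nball :: "('a \<Rightarrow> 'a set) \<Rightarrow> nat \<Rightarrow> 'a \<Rightarrow> 'a set" where
  "nball N 0 v = {v}"
| "nball N (Suc r) v = (\<Union>u\<in>nball N r v. insert u (N u))"

lemma nball_step: "u \<in> nball N r v \<Longrightarrow> w = u \<or> w \<in> N u \<Longrightarrow> w \<in> nball N (Suc r) v"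
  by auto

lemma nball_refl: "v \<in> nball N r v"
  by (induction r) auto

text \<open>The definition extends walks at the far end; the proof of symmetry needs the unfolding
  at the centre.\<close>

lemma nball_Suc_left: "nball N (Suc r) v = (\<Union>u\<in>insert v (N v). nball N r u)"
proof (induction r)
  case (Suc r)
  have "nball N (Suc (Suc r)) v = (\<Union>u\<in>nball N (Suc r) v. insert u (N u))" by simp
  also have "\<dots> = (\<Union>u\<in>(\<Union>u\<in>insert v (N v). nball N r u). insert u (N u))" unfolding Suc ..
  also have "\<dots> = (\<Union>u\<in>insert v (N v). nball N (Suc r) u)" by auto
  finally show ?case .
qed simp

lemma nball_sym:
  assumes "\<And>u v. u \<in> N v \<Longrightarrow> v \<in> N u"
  shows "u \<in> nball N r v \<Longrightarrow> v \<in> nball N r u"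
proof (induction r arbitrary: u)
  case (Suc r)
  then obtain x where x: "x \<in> nball N r v" "u = x \<or> u \<in> N x" by auto
  then have "v \<in> nball N r x" "x \<in> insert u (N u)" using Suc.IH assms by auto
  then show ?case unfolding nball_Suc_left by blast
qed simp

lemma nball_finite_card:
  assumes "\<And>v. finite (N v)" "\<And>v. card (N v) \<le> k"
  shows "finite (nball N r v) \<and> card (nball N r v) \<le> (k + 1) ^ r"
proof (induction r)
  case (Suc r)
  have "card (nball N (Suc r) v) \<le> (\<Sum>u\<in>nball N r v. card (insert u (N u)))"
    using Suc by (simp add: card_UN_le)
  also have "\<dots> \<le> (\<Sum>u\<in>nball N r v. k + 1)"
    using assms by (intro sum_mono) (simp add: card_insert_if le_SucI)
  also have "\<dots> \<le> (k + 1) ^ r * (k + 1)"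
    using Suc by (simp only: sum_constant of_nat_id mult_le_mono1)
  finally have "card (nball N (Suc r) v) \<le> (k + 1) ^ Suc r" by (simp only: power_Suc mult.commute)
  then show ?case using Suc assms by simp
qed simp

text \<open>The graph is given by its neighbourhood function \<open>N\<close>. Degree sums inside
  \<open>U\<close> count its edges twice, so \<open>density\<close> is the bound \<open>d\<close> on
  the maximum density. Girth at least 7 appears as the exclusion of cycles of length 3 to 6; with
  \<open>a = b = c\<close>, \<open>no_triangle\<close> also rules out loops.\<close>

locale sparse_graph =
  fixes V :: "'a set" and N :: "'a \<Rightarrow> 'a set" and \<Delta> d :: nat
  assumes finite_V: "finite V" and N_V: "u \<in> N v \<Longrightarrow> u \<in> V"
    and sym: "u \<in> N v \<Longrightarrow> v \<in> N u"
    and card_N: "card (N v) \<le> \<Delta>"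
    and density: "U \<subseteq> V \<Longrightarrow> (\<Sum>u\<in>U. card (N u \<inter> U)) \<le> d * card U"
    and d_pos: "d \<ge> 1"
    and no_triangle: "b \<in> N a \<Longrightarrow> c \<in> N b \<Longrightarrow> a \<in> N c \<Longrightarrow> False"
    and no_C4: "b \<in> N a \<Longrightarrow> c \<in> N b \<Longrightarrow> x \<in> N c \<Longrightarrow> a \<in> N x \<Longrightarrow> a = c \<or> b = x"
    and no_C5: "b \<in> N a \<Longrightarrow> c \<in> N b \<Longrightarrow> x \<in> N c \<Longrightarrow> y \<in> N x \<Longrightarrow> a \<in> N y \<Longrightarrow>
      \<not> distinct [a, b, c, x, y]"
    and no_C6: "b \<in> N a \<Longrightarrow> c \<in> N b \<Longrightarrow> x \<in> N c \<Longrightarrow> y \<in> N x \<Longrightarrow> z \<in> N y \<Longrightarrow> a \<in> N z \<Longrightarrow>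
      \<not> distinct [a, b, c, x, y, z]"
begin

lemma finite_N [simp]: "finite (N v)"
  by (rule finite_subset[OF _ finite_V]) (auto intro: N_V)

lemma N_irrefl: "v \<notin> N v"
  using no_triangle by blast

lemma separated_subset_nball:
  assumes "S \<subseteq> V"
  shows "\<exists>I\<subseteq>S. (\<forall>u\<in>I. \<forall>v\<in>I. u \<noteq> v \<longrightarrow> u \<notin> nball N r v) \<and> card S \<le> (\<Delta> + 1) ^ r * card I"
proof (rule separated_subset)
  show "finite S" using assms finite_V by (rule finite_subset)
  show "u \<in> nball N r v \<Longrightarrow> v \<in> nball N r u" for u v by (rule nball_sym[OF sym])
qed (use nball_finite_card[OF finite_N card_N] in \<open>auto intro: nball_refl\<close>)

definition separated :: "'a set \<Rightarrow> bool" where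
  "separated W \<longleftrightarrow> W \<subseteq> V \<and> (\<forall>u\<in>W. \<forall>v\<in>W. u \<noteq> v \<longrightarrow> u \<notin> nball N 6 v)"

text \<open>The average degree is at most \<open>d\<close>, so at least a fraction
  \<open>1 / (d + 1)\<close> of the vertices has degree at most \<open>d\<close>. The pigeonhole
  principle over the degrees costs a second factor \<open>d + 1\<close>, and the greedy choice costs
  the bound \<open>(\<Delta> + 1) ^ 6\<close> on the size of a ball.\<close>

lemma exists_separated:
  assumes "M * ((d + 1) ^ 2 * (\<Delta> + 1) ^ 6) \<le> card V"
  shows "\<exists>W k. separated W \<and> k \<le> d \<and> card W = M \<and> (\<forall>w\<in>W. card (N w) = k)"
proof -
  define L where "L = {v \<in> V. card (N v) \<le> d}"
  have L: "L \<subseteq> V" "finite L" using finite_V by (auto simp: L_def)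
  have "(d + 1) * card (V - L) \<le> (\<Sum>v\<in>V - L. card (N v))"
    using sum_bounded_below[of "V - L" "d + 1" "\<lambda>v. card (N v)"] by (simp add: L_def mult.commute not_le Suc_le_eq)
  also have "\<dots> \<le> (\<Sum>v\<in>V. card (N v))"
    using finite_V by (intro sum_mono2) auto
  also have "\<dots> = (\<Sum>v\<in>V. card (N v \<inter> V))"
    by (intro sum.cong arg_cong[where f = card]) (auto intro: N_V)
  also have "\<dots> \<le> d * card V" by (rule density) auto
  finally have "(d + 1) * card (V - L) \<le> d * card V" .
  moreover have "card V = card L + card (V - L)"
    using L finite_V by (metis card_Un_disjoint Diff_disjoint Un_Diff_cancel Un_absorb1 finite_Diff)
  ultimately have 1: "card V \<le> (d + 1) * card L" by (simp add: algebra_simps)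
  define Lk where "Lk k = {v \<in> L. card (N v) = k}" for k
  have "\<exists>k\<le>d. card L \<le> (d + 1) * card (Lk k)"
  proof (rule ccontr)
    assume "\<not> ?thesis"
    then have less: "(d + 1) * card (Lk k) < card L" if "k \<le> d" for k using that by auto
    have "L = (\<Union>k\<le>d. Lk k)" by (auto simp: Lk_def L_def)
    then have "card L \<le> (\<Sum>k\<le>d. card (Lk k))" by (metis card_UN_le finite_atMost)
    then have "(d + 1) * card L \<le> (\<Sum>k\<le>d. (d + 1) * card (Lk k))"
      by (metis mult_le_mono2 sum_distrib_left)
    also have "\<dots> < (\<Sum>k\<le>d. card L)" using less by (intro sum_strict_mono) auto
    finally show False by simp
  qed
  then obtain k where k: "k \<le> d" "card L \<le> (d + 1) * card (Lk k)" by blast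
  obtain I where I: "I \<subseteq> Lk k" "\<forall>u\<in>I. \<forall>v\<in>I. u \<noteq> v \<longrightarrow> u \<notin> nball N 6 v"
    "card (Lk k) \<le> (\<Delta> + 1) ^ 6 * card I"
    using separated_subset_nball[of "Lk k" 6] L(1) by (auto simp: Lk_def)
  have "card V \<le> (d + 1) * ((d + 1) * ((\<Delta> + 1) ^ 6 * card I))"
    using 1 k(2) I(3) by (meson le_trans mult_le_mono2)
  also have "\<dots> = card I * ((d + 1) ^ 2 * (\<Delta> + 1) ^ 6)"
    by (simp only: power2_eq_square mult_ac)
  finally have "M * ((d + 1) ^ 2 * (\<Delta> + 1) ^ 6) \<le> card I * ((d + 1) ^ 2 * (\<Delta> + 1) ^ 6)"
    using assms by linarith
  then have "M \<le> card I" by (subst (asm) mult_le_cancel2) auto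
  then obtain W where W: "W \<subseteq> I" "card W = M" by (meson obtain_subset_with_card_n)
  have "W \<subseteq> V" using W(1) I(1) L(1) by (auto simp: Lk_def)
  then have "separated W" using W(1) I(2) unfolding separated_def by blast
  moreover have "\<forall>w\<in>W. card (N w) = k" using W I by (auto simp: Lk_def)
  ultimately show ?thesis using W k by blast
qed

section \<open>Structure around a separated set\<close>

context
  fixes W assumes W: "separated W"
begin

text \<open>A walk of at most six steps joins \<open>w\<close> to \<open>w'\<close>. The four middle
  steps may stand still, so that one statement serves all walks of length 2 to 6.\<close>

lemma same_owner:
  assumes "w \<in> W" "w' \<in> W" "a \<in> N w" "b = a \<or> b \<in> N a" "c = b \<or> c \<in> N b"
    "x = c \<or> x \<in> N c" "y = x \<or> y \<in> N x" "w' \<in> N y"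
  shows "w' = w"
proof -
  have "a \<in> nball N (Suc 0) w" using assms(3) by simp
  note nball_step[OF this assms(4)]
  note nball_step[OF this assms(5)]
  note nball_step[OF this assms(6)]
  note nball_step[OF this assms(7)]
  note nball_step[OF this disjI2[OF assms(8)]]
  moreover have "Suc (Suc (Suc (Suc (Suc (Suc 0))))) = 6" by simp
  ultimately have "w' \<in> nball N 6 w" by argo
  then show ?thesis using W assms(1,2) unfolding separated_def by blast
qed

lemma W_disjoint_N: "w \<in> W \<Longrightarrow> w' \<in> W \<Longrightarrow> w \<noteq> w' \<Longrightarrow> N w \<inter> N w' = {}"
  using same_owner[of w w' a a a a a for a] sym by (metis disjoint_iff)

lemma W_disjoint_boundary: "W \<inter> \<Union>(N ` W) = {}"
proof (rule ccontr)
  assume "W \<inter> \<Union>(N ` W) \<noteq> {}"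
  then obtain w w' where ww: "w \<in> W" "w' \<in> W" "w' \<in> N w" by blast
  have "w \<in> N w'" using ww sym by blast
  \<comment> \<open>The walk runs back and forth along the edge between \<open>w\<close> and
    \<open>w'\<close>.\<close>
  then have "w' = w" using same_owner[of w w' w' w w' w'] ww by blast
  then show False using ww N_irrefl by blast
qed

text \<open>The two ends of such an edge would be neighbours of the same member of \<open>W\<close>
  and close a triangle with it.\<close>

lemma boundary_independent:
  assumes "b \<in> \<Union>(N ` W)" "b' \<in> \<Union>(N ` W)"
  shows "b' \<notin> N b"
proof
  assume bb: "b' \<in> N b"
  obtain w w' where w: "w \<in> W" "b \<in> N w" "w' \<in> W" "b' \<in> N w'" using assms by blast
  then have "w' = w" using same_owner[of w w' b b' b' b' b'] bb sym by blast
  then show False using no_triangle[of b w b'] w bb sym by blast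
qed

text \<open>Two distinct boundary neighbours of \<open>a\<close> would have the same neighbour
  \<open>w\<close> in \<open>W\<close>, which closes the 4-cycle \<open>w\<close>, \<open>b\<close>,
  \<open>a\<close>, \<open>b'\<close>.\<close>

lemma boundary_nbr_unique:
  assumes "a \<notin> W" "b \<in> N a" "b' \<in> N a" "b \<in> \<Union>(N ` W)" "b' \<in> \<Union>(N ` W)"
  shows "b = b'"
proof -
  obtain w w' where w: "w \<in> W" "b \<in> N w" "w' \<in> W" "b' \<in> N w'" using assms by blast
  then have "w' = w" using same_owner[of w w' b a b' b' b'] assms(2,3) sym by blast
  then show ?thesis using no_C4[of b a w b'] w assms(1-3) sym by blast
qed

text \<open>Girth 7 excludes the 4-, 5- and 6-cycles that a violation would close through \<open>W\<close>.\<close>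

lemma near_boundary_independent:
  assumes "a \<notin> W \<union> \<Union>(N ` W)" "a' \<notin> W \<union> \<Union>(N ` W)" "a' \<in> N a"
    and "N a \<inter> \<Union>(N ` W) \<noteq> {}" "N a' \<inter> \<Union>(N ` W) \<noteq> {}"
  shows False
proof -
  obtain b w b' w' where w: "w \<in> W" "b \<in> N w" "b \<in> N a" "w' \<in> W" "b' \<in> N w'" "b' \<in> N a'"
    using assms(4,5) by blast
  have s: "w \<in> N b" "a \<in> N b" "w' \<in> N b'" "a' \<in> N b'" "a \<in> N a'"
    using w assms(3) sym by blast+
  have "w' = w" using same_owner[of w w' b a a' b' b'] w s assms(3) by blast
  have "b \<noteq> b'" using no_triangle[of a' a b] assms(3) w s by blast
  then have "distinct [w, b, a, a', b']"
    using assms(1-3) w s W_disjoint_boundary N_irrefl \<open>w' = w\<close> by auto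
  then show False using no_C5[of b w a a' b'] w s assms(3) \<open>w' = w\<close> by blast
qed

text \<open>Here the walk from \<open>w\<close> to \<open>w'\<close> through \<open>b\<close>,
  \<open>a\<close>, \<open>x\<close>, \<open>a'\<close>, \<open>b'\<close> uses all six steps, which
  is why \<open>separated\<close> excludes balls of radius 6.\<close>

lemma near_boundary_nbr_unique:
  assumes out: "a \<notin> W \<union> \<Union>(N ` W)" "a' \<notin> W \<union> \<Union>(N ` W)" "x \<notin> W \<union> \<Union>(N ` W)"
    and adj: "a \<in> N x" "a' \<in> N x"
    and "N a \<inter> \<Union>(N ` W) \<noteq> {}" "N a' \<inter> \<Union>(N ` W) \<noteq> {}"
  shows "a = a'"
proof (rule ccontr)
  assume neq: "a \<noteq> a'"
  obtain b w b' w' where w: "w \<in> W" "b \<in> N w" "b \<in> N a" "w' \<in> W" "b' \<in> N w'" "b' \<in> N a'"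
    using assms(6,7) by blast
  have s: "w \<in> N b" "a \<in> N b" "w' \<in> N b'" "a' \<in> N b'" "x \<in> N a" "x \<in> N a'"
    using w adj sym by blast+
  have "w' = w" using same_owner[of w w' b a x a' b'] w s adj by blast
  have "b \<noteq> x" using w out by blast
  then have "b \<noteq> b'" using no_C4[of x a a' b] neq w s adj by blast
  then have "distinct [w, b, a, x, a', b']"
    using out neq adj w s W_disjoint_boundary N_irrefl \<open>w' = w\<close> by auto
  then show False using no_C6[of b w a x a' b'] w s adj \<open>w' = w\<close> by blast
qed

text \<open>The density bound controls only neighbours within \<open>A\<close>, and a boundary
  neighbour may spoil it. But vertices of \<open>A\<close> with a boundary neighbour are independent
  and have no common neighbour in \<open>A\<close>, so those of high degree inject into the
  remaining vertices of \<open>A\<close>. This makes them few enough for the averaging argument to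
  go through.\<close>

lemma many_low_vertices:
  assumes A: "A \<subseteq> V - (W \<union> \<Union>(N ` W))"
  shows "card A \<le> 2 * (d + 1) * card {a \<in> A. card (N a \<inter> (\<Union>(N ` W) \<union> A)) \<le> d}"
proof -
  let ?B = "\<Union>(N ` W)"
  define L where "L = {a \<in> A. card (N a \<inter> (?B \<union> A)) \<le> d}"
  define A1 where "A1 = {a \<in> A. N a \<inter> ?B \<noteq> {}}"
  define H1 where "H1 = A1 - L"
  define H2 where "H2 = A - L - A1"
  have out: "a \<notin> W \<union> ?B" if "a \<in> A" for a using that A by blast
  have fin: "finite A" using A finite_V finite_subset by blast
  then have fins: "finite L" "finite H1" "finite H2" "finite A1"
    by (auto simp: L_def H1_def H2_def A1_def)
  have cardA: "card A = card L + card H1 + card H2"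
  proof -
    have "A = (L \<union> H1) \<union> H2" "L \<inter> H1 = {}" "(L \<union> H1) \<inter> H2 = {}"
      by (auto simp: L_def H1_def H2_def A1_def)
    then show ?thesis using fins by (metis card_Un_disjoint finite_UnI)
  qed
  have high: "d + 1 \<le> card (N a \<inter> ?B) + card (N a \<inter> A)" if "a \<in> A" "a \<notin> L" for a
  proof -
    have "d + 1 \<le> card (N a \<inter> (?B \<union> A))" using that by (auto simp: L_def)
    also have "\<dots> = card ((N a \<inter> ?B) \<union> (N a \<inter> A))" by (simp add: Int_Un_distrib)
    also have "\<dots> \<le> card (N a \<inter> ?B) + card (N a \<inter> A)" by (rule card_Un_le)
    finally show ?thesis .
  qed
  have "card (N a \<inter> ?B) \<le> Suc 0" if "a \<in> A" for a
    using boundary_nbr_unique[of a] out[OF that]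
    by (subst card_le_Suc0_iff_eq) auto
  then have H1: "d \<le> card (N a \<inter> A)" if "a \<in> H1" for a
    using high[of a] that by (fastforce simp: H1_def A1_def)
  have H2: "d + 1 \<le> card (N a \<inter> A)" if "a \<in> H2" for a
    using high[of a] that by (auto simp: H2_def A1_def)
  \<comment> \<open>Vertices of \<open>H1\<close> have at least \<open>d\<close>, hence at least
    one, neighbour in \<open>A\<close>. The chosen neighbours lie outside \<open>A1\<close> and are
    pairwise distinct, which bounds \<open>H1\<close> by \<open>L\<close> and
    \<open>H2\<close>.\<close>
  have "\<exists>g. \<forall>a\<in>H1. g a \<in> N a \<inter> A"
    using H1 d_pos by (intro bchoice ballI) (metis card.empty ex_in_conv not_one_le_zero order_trans)
  then obtain g where g: "\<And>a. a \<in> H1 \<Longrightarrow> g a \<in> N a \<inter> A" by blast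
  have "inj_on g H1"
  proof (rule inj_onI)
    fix a a' assume a: "a \<in> H1" "a' \<in> H1" "g a = g a'"
    then have mem: "a \<in> A" "a' \<in> A" "a \<in> A1" "a' \<in> A1" by (auto simp: H1_def A1_def)
    show "a = a'"
    proof (rule near_boundary_nbr_unique)
      show "a \<in> N (g a)" "a' \<in> N (g a)" using g[OF a(1)] g[OF a(2)] a(3) sym by auto
    qed (use mem out g[OF a(1)] in \<open>auto simp: A1_def\<close>)
  qed
  moreover have "g ` H1 \<subseteq> A - A1"
  proof (intro subsetI, elim imageE)
    fix x a assume a: "a \<in> H1" "x = g a"
    then have "a \<in> A" "a \<in> A1" by (auto simp: H1_def A1_def)
    moreover have "x \<in> A" "x \<in> N a" using g[OF a(1)] a(2) by auto
    ultimately show "x \<in> A - A1"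
      using near_boundary_independent[OF out[of a] out[of x]] by (auto simp: A1_def)
  qed
  ultimately have "card H1 \<le> card (A - A1)" using fin by (intro card_inj_on_le) auto
  also have "\<dots> \<le> card (L \<union> H2)"
    using fins by (intro card_mono) (auto simp: H2_def)
  also have "\<dots> \<le> card L + card H2" by (rule card_Un_le)
  finally have h1: "card H1 \<le> card L + card H2" .
  have "d * card H1 + (d + 1) * card H2 \<le> (\<Sum>a\<in>H1. card (N a \<inter> A)) + (\<Sum>a\<in>H2. card (N a \<inter> A))"
    using sum_bounded_below[of H1 d "\<lambda>a. card (N a \<inter> A)"]
      sum_bounded_below[of H2 "d + 1" "\<lambda>a. card (N a \<inter> A)"] H1 H2
    by (simp add: mult.commute)
  also have "\<dots> = (\<Sum>a\<in>H1 \<union> H2. card (N a \<inter> A))"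
    using fins by (intro sum.union_disjoint[symmetric]) (auto simp: H1_def H2_def)
  also have "\<dots> \<le> (\<Sum>a\<in>A. card (N a \<inter> A))"
    using fin by (intro sum_mono2) (auto simp: H1_def H2_def A1_def)
  also have "\<dots> \<le> d * card A" using A by (intro density) auto
  \<comment> \<open>After cancelling \<open>d * card H1\<close> on both sides, the surplus neighbour
    of each vertex of \<open>H2\<close> is paid for by \<open>L\<close>.\<close>
  finally have "card H2 \<le> d * card L" unfolding cardA by (simp add: algebra_simps)
  then have "card A \<le> 2 * (d + 1) * card L" using h1 unfolding cardA by (simp add: algebra_simps)
  then show ?thesis unfolding L_def .
qed

text \<open>The stages are found from last to first. A 2-separated subset of the low vertices of
  \<open>A\<close> becomes the final stage: a low vertex has few neighbours even in the boundary and
  all of \<open>A\<close>, hence in the boundary and the earlier stages. Each round removes at least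
  the fraction \<open>1 / (2 * (d + 1) * (\<Delta> + 1) ^ 2)\<close> of \<open>A\<close>, and a set
  of size below 1 is empty.\<close>

lemma exists_stages:
  assumes "A \<subseteq> V - (W \<union> \<Union>(N ` W))"
    and "real (card A) * (1 - 1 / real (2 * (d + 1) * (\<Delta> + 1) ^ 2)) ^ T < 1"
  shows "\<exists>S. A = (\<Union>i<T. S i) \<and> (\<forall>i<T. \<forall>j<i. S i \<inter> S j = {}) \<and>
    (\<forall>i<T. \<forall>u\<in>S i. \<forall>v\<in>S i. u \<noteq> v \<longrightarrow> u \<notin> nball N 2 v) \<and>
    (\<forall>i<T. \<forall>v\<in>S i. card (N v \<inter> (\<Union>(N ` W) \<union> (\<Union>j<i. S j))) \<le> d)"
  using assms
proof (induction T arbitrary: A)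
  case 0
  then have "finite A" using finite_V finite_subset by blast
  then have "A = {}" using 0(2) by simp
  then show ?case by auto
next
  case (Suc T)
  let ?c = "2 * (d + 1) * (\<Delta> + 1) ^ 2"
  let ?L = "{a \<in> A. card (N a \<inter> (\<Union>(N ` W) \<union> A)) \<le> d}"
  obtain I where I: "I \<subseteq> ?L" "\<forall>u\<in>I. \<forall>v\<in>I. u \<noteq> v \<longrightarrow> u \<notin> nball N 2 v"
    "card ?L \<le> (\<Delta> + 1) ^ 2 * card I"
    using separated_subset_nball[of ?L 2] Suc.prems(1) by blast
  have finA: "finite A" using Suc.prems(1) finite_V finite_subset by blast
  have "card A \<le> 2 * (d + 1) * card ?L" by (rule many_low_vertices[OF Suc.prems(1)])
  also have "\<dots> \<le> 2 * (d + 1) * ((\<Delta> + 1) ^ 2 * card I)" using I(3) by (rule mult_le_mono2)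
  finally have cA: "card A \<le> ?c * card I" by (simp only: mult.assoc)
  have "?c \<ge> 1" by (simp add: Suc_le_eq)
  then have c_pos: "real ?c \<ge> 1" by (metis of_nat_1 of_nat_le_iff)
  have "I \<subseteq> A" using I(1) by blast
  then have "card I \<le> card A" "card (A - I) = card A - card I"
    using finA by (auto intro: card_mono card_Diff_subset finite_subset)
  then have diff: "real (card (A - I)) = real (card A) - real (card I)"
    by (simp add: of_nat_diff)
  have "real (card A) \<le> real ?c * real (card I)" using cA by (metis of_nat_le_iff of_nat_mult)
  then have "real (card A) / real ?c \<le> real (card I)"
    using c_pos by (subst pos_divide_le_eq) (linarith, simp only: mult.commute)
  then have less: "real (card (A - I)) \<le> real (card A) * (1 - 1 / real ?c)"
    unfolding diff by (simp only: right_diff_distrib mult_1_right times_divide_eq_right diff_left_mono)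
  have "1 - 1 / real ?c \<ge> 0" using c_pos by simp
  then have "real (card (A - I)) * (1 - 1 / real ?c) ^ T \<le> real (card A) * (1 - 1 / real ?c) ^ Suc T"
    using mult_right_mono[OF less zero_le_power[of _ T]] by (simp add: mult.assoc)
  then have less1: "real (card (A - I)) * (1 - 1 / real ?c) ^ T < 1" using Suc.prems(2) by linarith
  have "A - I \<subseteq> V - (W \<union> \<Union>(N ` W))" using Suc.prems(1) by blast
  from Suc.IH[OF this less1]
  obtain S where stages: "A - I = (\<Union>i<T. S i) \<and> (\<forall>i<T. \<forall>j<i. S i \<inter> S j = {}) \<and>
    (\<forall>i<T. \<forall>u\<in>S i. \<forall>v\<in>S i. u \<noteq> v \<longrightarrow> u \<notin> nball N 2 v) \<and>
    (\<forall>i<T. \<forall>v\<in>S i. card (N v \<inter> (\<Union>(N ` W) \<union> (\<Union>j<i. S j))) \<le> d)" ..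
  note S = stages[THEN conjunct1] stages[THEN conjunct2, THEN conjunct1, rule_format]
    stages[THEN conjunct2, THEN conjunct2, THEN conjunct1, rule_format]
    stages[THEN conjunct2, THEN conjunct2, THEN conjunct2, rule_format]
  define S' where "S' = S(T := I)"
  have UN: "(\<Union>j<i. S' j) = (\<Union>j<i. S j)" if "i \<le> T" for i
    using that by (auto simp: S'_def)
  show ?case
  proof (intro exI[of _ S'] conjI allI impI ballI)
    show "A = (\<Union>i<Suc T. S' i)"
      using S(1) I(1) UN[of T] by (auto simp: lessThan_Suc S'_def)
    show "S' i \<inter> S' j = {}" if "i < Suc T" "j < i" for i j
    proof (cases "i = T")
      case True
      then have "S j \<subseteq> A - I" using S(1) that(2) by blast
      then show ?thesis using True that(2) by (auto simp: S'_def)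
    next
      case False
      then show ?thesis using S(2)[of i j] that by (simp add: S'_def)
    qed
    show "u \<notin> nball N 2 v" if "i < Suc T" "u \<in> S' i" "v \<in> S' i" "u \<noteq> v" for i u v
      using that S(3)[of i u v] I(2) by (cases "i = T") (auto simp: S'_def)
    show "card (N v \<inter> (\<Union>(N ` W) \<union> (\<Union>j<i. S' j))) \<le> d" if "i < Suc T" "v \<in> S' i" for i v
    proof (cases "i = T")
      case True
      have "card (N v \<inter> (\<Union>(N ` W) \<union> (A - I))) \<le> card (N v \<inter> (\<Union>(N ` W) \<union> A))"
        by (intro card_mono) auto
      moreover have "v \<in> ?L" using True that I(1) by (auto simp: S'_def)
      ultimately show ?thesis using True UN[of T] S(1) by auto
    next
      case False
      then show ?thesis using S(4)[of i v] UN[of i] that by (simp add: S'_def)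
    qed
  qed
qed

end

end

subsection \<open>The random graph\<close>

text \<open>Independence: \<open>P\<close> looks only at the coordinates in \<open>A\<close> and
  \<open>Q\<close> only at those in \<open>B\<close>.\<close>

lemma prob_Pi_pmf_union:
  assumes "finite A" "finite B" "A \<inter> B = {}"
    and P: "\<And>f g. (\<And>x. x \<in> A \<Longrightarrow> f x = g x) \<Longrightarrow> P f \<longleftrightarrow> P g"
    and Q: "\<And>f g. (\<And>x. x \<in> B \<Longrightarrow> f x = g x) \<Longrightarrow> Q f \<longleftrightarrow> Q g"
  shows "measure_pmf.prob (Pi_pmf (A \<union> B) dflt p) {f. P f \<and> Q f} =
    measure_pmf.prob (Pi_pmf A dflt p) {f. P f} * measure_pmf.prob (Pi_pmf B dflt p) {f. Q f}"
proof -
  let ?MA = "Pi_pmf A dflt p" and ?MB = "Pi_pmf B dflt p"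
  let ?h = "\<lambda>(f, g) x. if x \<in> A then f x else g x"
  have "P (?h (f, g)) \<longleftrightarrow> P f" "Q (?h (f, g)) \<longleftrightarrow> Q g" for f g
    using assms(3) by (auto intro!: P Q)
  then have "?h -` {f. P f \<and> Q f} = {f. P f} \<times> {g. Q g}" by auto
  then have "measure_pmf.prob (Pi_pmf (A \<union> B) dflt p) {f. P f \<and> Q f} =
    measure_pmf.prob (pair_pmf ?MA ?MB) ({f. P f} \<times> {g. Q g})"
    by (simp add: Pi_pmf_union[OF assms(1-3)])
  also have "\<dots> = measure_pmf.prob ?MA {f. P f} * measure_pmf.prob ?MB {g. Q g}"
  proof -
    \<comment> \<open>The product rule requires countable sets, so both events are restricted to the
      supports.\<close>
    have "measure_pmf.prob (pair_pmf ?MA ?MB) ({f. P f} \<times> {g. Q g}) =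
       measure_pmf.prob (pair_pmf ?MA ?MB)
         (({f. P f} \<inter> set_pmf ?MA) \<times> ({g. Q g} \<inter> set_pmf ?MB))"
      by (rule measure_prob_cong_0) (auto simp: pmf_pair set_pmf_eq)
    also have "\<dots> = measure_pmf.prob ?MA ({f. P f} \<inter> set_pmf ?MA) *
        measure_pmf.prob ?MB ({g. Q g} \<inter> set_pmf ?MB)"
      by (rule measure_pmf_prob_product) auto
    finally show ?thesis by (simp add: measure_Int_set_pmf)
  qed
  finally show ?thesis .
qed

lemma prob_bernoulli_all_True:
  assumes "finite A" "c \<subseteq> A" "0 \<le> p" "p \<le> 1"
  shows "measure_pmf.prob (Pi_pmf A False (\<lambda>_. bernoulli_pmf p)) {b. \<forall>e\<in>c. b e} = p ^ card c"
proof -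
  have "{b. \<forall>e\<in>c. b e} = Pi A (\<lambda>e. if e \<in> c then {True} else UNIV)"
    using assms(2) by (auto simp: Pi_iff split: if_splits)
  then have "measure_pmf.prob (Pi_pmf A False (\<lambda>_. bernoulli_pmf p)) {b. \<forall>e\<in>c. b e} =
    (\<Prod>e\<in>A. measure_pmf.prob (bernoulli_pmf p) (if e \<in> c then {True} else UNIV))"
    using measure_Pi_pmf_Pi[OF assms(1)] by simp
  also have "\<dots> = (\<Prod>e\<in>A. if e \<in> c then p else 1)"
    using assms(3,4) by (intro prod.cong) (auto simp: measure_pmf_single)
  also have "\<dots> = (\<Prod>e\<in>c. p)"
    using assms(1,2) by (simp add: prod.If_cases Int_absorb1)
  finally show ?thesis by simp
qed

text \<open>Disjoint sets of coordinates are independent, and all coordinates of \<open>c\<close>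
  are true with probability \<open>p ^ card c\<close>. The induction splits \<open>A\<close> into
  \<open>c\<close> and the rest, so \<open>A\<close> has to vary.\<close>

lemma prob_bernoulli_none_full:
  assumes "finite C" "finite A" "\<And>c. c \<in> C \<Longrightarrow> c \<subseteq> A" "pairwise disjnt C" "0 \<le> p" "p \<le> 1"
  shows "measure_pmf.prob (Pi_pmf A False (\<lambda>_. bernoulli_pmf p)) {b. \<forall>c\<in>C. \<exists>e\<in>c. \<not> b e}
    = (\<Prod>c\<in>C. 1 - p ^ card c)"
  using assms
proof (induction C arbitrary: A rule: finite_induct)
  case (insert c C)
  let ?M = "\<lambda>A. Pi_pmf A False (\<lambda>_. bernoulli_pmf p)"
  have c: "c \<subseteq> A" "finite c"
    using insert.prems(2)[of c] finite_subset[OF _ insert.prems(1)] by auto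
  have disj: "c \<inter> c' = {}" if "c' \<in> C" for c'
    using insert.prems(3) insert.hyps(2) that by (auto simp: pairwise_insert disjnt_def)
  have "A = c \<union> (A - c)" using c by blast
  then have "measure_pmf.prob (?M A) {b. \<forall>c\<in>insert c C. \<exists>e\<in>c. \<not> b e} =
    measure_pmf.prob (?M (c \<union> (A - c))) {b. (\<exists>e\<in>c. \<not> b e) \<and> (\<forall>c\<in>C. \<exists>e\<in>c. \<not> b e)}"
    by simp
  also have "\<dots> = measure_pmf.prob (?M c) {b. \<exists>e\<in>c. \<not> b e} *
      measure_pmf.prob (?M (A - c)) {b. \<forall>c\<in>C. \<exists>e\<in>c. \<not> b e}"
  proof (rule prob_Pi_pmf_union)
    fix f g :: "'a \<Rightarrow> bool"
    assume fg: "\<And>x. x \<in> A - c \<Longrightarrow> f x = g x"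
    have "f e = g e" if "e \<in> c'" "c' \<in> C" for e c'
      using that disj[OF that(2)] insert.prems(2)[of c'] by (intro fg) auto
    then show "(\<forall>c\<in>C. \<exists>e\<in>c. \<not> f e) \<longleftrightarrow> (\<forall>c\<in>C. \<exists>e\<in>c. \<not> g e)" by metis
  qed (use c insert.prems in auto)
  also have "measure_pmf.prob (?M (A - c)) {b. \<forall>c\<in>C. \<exists>e\<in>c. \<not> b e} = (\<Prod>c\<in>C. 1 - p ^ card c)"
    using insert.prems disj by (intro insert.IH) (auto simp: pairwise_insert)
  also have "{b. \<exists>e\<in>c. \<not> b e} = UNIV - {b. \<forall>e\<in>c. b e}" by auto
  also have "measure_pmf.prob (?M c) \<dots> = 1 - p ^ card c"
    using prob_bernoulli_all_True[OF c(2) order.refl insert.prems(4,5)]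
    by (subst measure_pmf.prob_compl[simplified]) auto
  finally show ?case using insert.hyps by simp
qed simp

text \<open>Stands for the images of the embedded neighbourhoods of a set of vertices that wait for
  their own images. Vertices without embedded neighbours are handled apart, hence the sets are
  nonempty.\<close>

definition small_family :: "nat \<Rightarrow> nat \<Rightarrow> nat set set \<Rightarrow> bool" where
  "small_family n d \<D> \<longleftrightarrow> (\<forall>D\<in>\<D>. D \<subseteq> {..<n} \<and> D \<noteq> {} \<and> card D \<le> d) \<and> pairwise disjnt \<D>"

definition no_common_nbr :: "'a set set \<Rightarrow> 'a set set \<Rightarrow> 'a set \<Rightarrow> bool" where
  "no_common_nbr E \<D> Y \<longleftrightarrow> (\<forall>D\<in>\<D>. \<forall>v\<in>Y. \<exists>u\<in>D. {u, v} \<notin> E)"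

lemma small_family_finite: "small_family n d \<D> \<Longrightarrow> finite \<D>"
  by (rule finite_subset[of _ "Pow {..<n}"]) (auto simp: small_family_def)

lemma small_family_subset: "small_family n d \<D> \<Longrightarrow> \<D>' \<subseteq> \<D> \<Longrightarrow> small_family n d \<D>'"
  by (auto simp: small_family_def intro: pairwise_subset)

text \<open>Each \<open>D\<close> and each \<open>v\<close> in \<open>Y\<close> span a star of at
  most \<open>d\<close> pairs. The stars are disjoint because the sets \<open>D\<close> are disjoint
  and avoid \<open>Y\<close>, so the events that a star lacks an edge are independent, each of
  probability at most \<open>1 - p ^ d \<le> exp (- (p ^ d))\<close>.\<close>

lemma prob_no_common_nbr:
  assumes fam: "small_family n d \<D>" and Y: "Y \<subseteq> {..<n}" "Y \<inter> \<Union>\<D> = {}"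
    and p: "0 \<le> p" "p \<le> 1"
  shows "measure_pmf.prob (random_graph n p) {G. no_common_nbr (edges G) \<D> Y}
    \<le> exp (- (p ^ d * real (card \<D> * card Y)))"
proof -
  let ?A = "[{..<n}]\<^bsup>2\<^esup>"
  let ?c = "\<lambda>(D, v). (\<lambda>u. {u, v}) ` D"
  define C where "C = ?c ` (\<D> \<times> Y)"
  have finY: "finite Y" using Y(1) finite_subset by blast
  have D: "D \<subseteq> {..<n}" "D \<noteq> {}" "card D \<le> d" "finite D" "D \<inter> Y = {}" if "D \<in> \<D>" for D
    using fam that Y(2) by (auto simp: small_family_def intro: finite_subset)
  \<comment> \<open>Membership in \<open>Y\<close> tells the centre of a star from its leaves, and a
    leaf determines \<open>D\<close>.\<close>
  have same: "D = D' \<and> v = v'"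
    if "D \<in> \<D>" "D' \<in> \<D>" "v \<in> Y" "v' \<in> Y" "e \<in> ?c (D, v)" "e \<in> ?c (D', v')" for D D' v v' e
  proof -
    from that obtain u u' where u: "u \<in> D" "u' \<in> D'" "{u, v} = {u', v'}" by auto
    then have "u \<notin> Y" "u' \<notin> Y" using that D(5) by blast+
    then have "u = u'" "v = v'" using u(3) that(3,4) by (auto simp: doubleton_eq_iff)
    moreover have "D = D'"
      using u(1,2) \<open>u = u'\<close> that(1,2) fam
      unfolding small_family_def pairwise_def disjnt_def by blast
    ultimately show ?thesis by blast
  qed
  have inj: "inj_on ?c (\<D> \<times> Y)"
  proof (rule inj_onI)
    fix x y assume xy: "x \<in> \<D> \<times> Y" "y \<in> \<D> \<times> Y" "?c x = ?c y"
    obtain e where "e \<in> ?c x" using xy(1) D(2) by fastforce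
    then show "x = y" using same[of "fst x" "fst y" "snd x" "snd y" e] xy
      by (auto simp: prod_eq_iff)
  qed
  have disj: "pairwise disjnt C"
  proof (rule pairwiseI)
    fix a b assume ab: "a \<in> C" "b \<in> C" "a \<noteq> b"
    show "disjnt a b"
    proof (rule ccontr)
      assume "\<not> disjnt a b"
      then obtain e where e: "e \<in> a" "e \<in> b" by (auto simp: disjnt_def)
      obtain x y where xy: "a = ?c x" "b = ?c y" "x \<in> \<D> \<times> Y" "y \<in> \<D> \<times> Y"
        using ab(1,2) unfolding C_def by blast
      then have "x = y" using same[of "fst x" "fst y" "snd x" "snd y" e] e
        by (auto simp: prod_eq_iff)
      then show False using ab(3) xy by simp
    qed
  qed
  have sub: "c \<subseteq> ?A" if "c \<in> C" for c
    using that D(1,5) Y(1) by (fastforce simp: C_def)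
  have "measure_pmf.prob (random_graph n p) {G. no_common_nbr (edges G) \<D> Y} =
    measure_pmf.prob (Pi_pmf ?A False (\<lambda>_. bernoulli_pmf p)) {b. \<forall>c\<in>C. \<exists>e\<in>c. \<not> b e}"
  proof -
    have "{u, v} \<in> ?A" if "u \<in> D" "D \<in> \<D>" "v \<in> Y" for u v D
      using that D(1)[of D] D(5)[of D] Y(1) by auto
    then have "no_common_nbr {e \<in> ?A. b e} \<D> Y \<longleftrightarrow> (\<forall>c\<in>C. \<exists>e\<in>c. \<not> b e)" for b
      unfolding no_common_nbr_def C_def by (auto simp: Ball_def Bex_def)
    then show ?thesis by (simp add: random_graph_def vimage_def)
  qed
  also have "\<dots> = (\<Prod>c\<in>C. 1 - p ^ card c)"
    using small_family_finite[OF fam] finY sub disj p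
    by (intro prob_bernoulli_none_full) (auto simp: C_def finite_imp_finite_nsets)
  also have "\<dots> = (\<Prod>(D, v)\<in>\<D> \<times> Y. 1 - p ^ card D)"
    unfolding C_def using D(4,5)
    by (subst prod.reindex[OF inj])
       (auto intro!: prod.cong arg_cong[where f = "\<lambda>k. p ^ k"] card_image
          simp: inj_on_def doubleton_eq_iff)
  also have "\<dots> \<le> (\<Prod>x\<in>\<D> \<times> Y. exp (- (p ^ d)))"
  proof (rule prod_mono, clarify)
    fix D v assume "D \<in> \<D>" "v \<in> Y"
    then have "p ^ d \<le> p ^ card D" using D(3) p by (intro power_decreasing) auto
    then show "0 \<le> 1 - p ^ card D \<and> 1 - p ^ card D \<le> exp (- (p ^ d))"
      using p exp_ge_add_one_self[of "- (p ^ d)"] by (auto simp: power_le_one)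
  qed
  also have "\<dots> = exp (- (p ^ d * real (card \<D> * card Y)))"
    by (simp add: card_cartesian_product exp_of_nat_mult[symmetric] mult.commute)
  finally show ?thesis .
qed

text \<open>Repeating one element turns such a set into a list of length \<open>d\<close>, so the
  lists of length \<open>d\<close> cover all these sets.\<close>

lemma card_small_sets_le:
  fixes d :: nat
  assumes "d \<ge> 1"
  shows "finite {D. D \<subseteq> {..<n} \<and> D \<noteq> {} \<and> card D \<le> d}" (is "finite ?S")
    and "card {D. D \<subseteq> {..<n} \<and> D \<noteq> {} \<and> card D \<le> d} \<le> n ^ d"
proof -
  let ?L = "{xs. set xs \<subseteq> {..<n} \<and> length xs = d}"
  have "?S \<subseteq> set ` ?L"
  proof
    fix D assume D: "D \<in> ?S"
    then have fin: "finite D" using finite_subset by blast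
    obtain x where x: "x \<in> D" using D by blast
    let ?xs = "sorted_list_of_set D @ replicate (d - card D) x"
    have "set ?xs = D" "length ?xs = d" using D fin x by auto
    then show "D \<in> set ` ?L" using D by (intro image_eqI[of _ _ ?xs]) auto
  qed
  moreover have fin: "finite ?L" by (rule finite_lists_length_eq) simp
  ultimately have "card ?S \<le> card (set ` ?L)" by (intro card_mono) auto
  also have "\<dots> \<le> card ?L" by (rule card_image_le[OF fin])
  also have "card ?L = n ^ d" by (subst card_lists_length_eq) auto
  finally show "card ?S \<le> n ^ d" .
qed auto

lemma card_subsets_le_power:
  assumes "finite A" "card A \<le> N"
  shows "card {B. B \<subseteq> A \<and> card B = k} \<le> N ^ k"
proof -
  have "card {B. B \<subseteq> A \<and> card B = k} = card A choose k"
    using assms(1) by (rule n_subsets)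
  also have "\<dots> \<le> card A ^ k"
    by (cases "k \<le> card A") (auto simp: binomial_le_pow binomial_eq_0)
  also have "\<dots> \<le> N ^ k" using assms(2) by (rule power_mono) simp
  finally show ?thesis .
qed

lemma card_small_families_le:
  assumes "d \<ge> 1"
  shows "finite {\<D>. small_family n d \<D> \<and> card \<D> = x}" (is "finite ?F")
    and "card {\<D>. small_family n d \<D> \<and> card \<D> = x} \<le> n ^ (d * x)"
proof -
  let ?S = "{D. D \<subseteq> {..<n} \<and> D \<noteq> {} \<and> card D \<le> d}"
  have sub: "?F \<subseteq> {\<D>. \<D> \<subseteq> ?S \<and> card \<D> = x}"
    by (auto simp: small_family_def)
  have fin: "finite {\<D>. \<D> \<subseteq> ?S \<and> card \<D> = x}"
    by (rule finite_subset[of _ "Pow ?S"]) (use card_small_sets_le(1)[OF assms] in auto)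
  show "finite ?F" using sub fin finite_subset by blast
  have "card ?F \<le> card {\<D>. \<D> \<subseteq> ?S \<and> card \<D> = x}"
    using sub fin by (rule card_mono[rotated])
  also have "\<dots> \<le> (n ^ d) ^ x"
    using card_small_sets_le[OF assms] by (rule card_subsets_le_power)
  finally show "card ?F \<le> n ^ (d * x)" by (simp add: power_mult)
qed

text \<open>Union bound over at most \<open>n ^ ((d + 1) * x)\<close> pairs, each failing with
  probability at most exp (- x (d + 4) log n). Of the \<open>d + 4\<close>, \<open>d\<close> pays
  for the families, 1 for the vertex sets, and 3 remains.\<close>

lemma prob_some_no_common_nbr:
  assumes "finite C" "card C \<le> n ^ ((d + 1) * x)" "x \<ge> 1" "n \<ge> 1" "0 \<le> p" "p \<le> 1"
    and s: "p ^ d * real s \<ge> real (d + 4) * ln (real n)"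
    and C: "\<And>\<D> Y. (\<D>, Y) \<in> C \<Longrightarrow> small_family n d \<D> \<and> Y \<subseteq> {..<n} \<and> Y \<inter> \<Union>\<D> = {}
      \<and> x * s \<le> card \<D> * card Y"
  shows "measure_pmf.prob (random_graph n p) {G. \<exists>(\<D>, Y)\<in>C. no_common_nbr (edges G) \<D> Y}
    \<le> 1 / real n ^ 3"
proof -
  let ?M = "random_graph n p" and ?L = "ln (real n)"
  have L: "?L \<ge> 0" using assms(4) by simp
  have ev: "{G. \<exists>(\<D>, Y)\<in>C. no_common_nbr (edges G) \<D> Y} =
    (\<Union>P\<in>C. {G. no_common_nbr (edges G) (fst P) (snd P)})" by (auto simp: case_prod_unfold)
  have "measure_pmf.prob ?M {G. \<exists>(\<D>, Y)\<in>C. no_common_nbr (edges G) \<D> Y} \<le>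
    (\<Sum>P\<in>C. measure_pmf.prob ?M {G. no_common_nbr (edges G) (fst P) (snd P)})"
    unfolding ev using assms(1) by (intro measure_pmf.finite_measure_subadditive_finite) auto
  also have "\<dots> \<le> (\<Sum>P\<in>C. exp (- (real x * (real (d + 4) * ?L))))"
  proof (rule sum_mono)
    fix P assume P: "P \<in> C"
    note CP = C[of "fst P" "snd P", simplified, OF P]
    have "measure_pmf.prob ?M {G. no_common_nbr (edges G) (fst P) (snd P)}
      \<le> exp (- (p ^ d * real (card (fst P) * card (snd P))))"
      using CP assms(5,6) by (intro prob_no_common_nbr) auto
    also have "\<dots> \<le> exp (- (p ^ d * real (x * s)))"
      unfolding exp_le_cancel_iff neg_le_iff_le
      by (rule mult_left_mono) (use CP assms(5) in \<open>simp_all only: of_nat_le_iff zero_le_power\<close>)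
    also have "p ^ d * real (x * s) = real x * (p ^ d * real s)" by simp
    also have "exp (- \<dots>) \<le> exp (- (real x * (real (d + 4) * ?L)))"
      unfolding exp_le_cancel_iff neg_le_iff_le
      by (rule mult_left_mono) (use s in simp_all)
    finally show "measure_pmf.prob ?M {G. no_common_nbr (edges G) (fst P) (snd P)}
      \<le> exp (- (real x * (real (d + 4) * ?L)))" .
  qed
  also have "\<dots> \<le> real n ^ ((d + 1) * x) * exp (- (real x * (real (d + 4) * ?L)))"
  proof -
    have "real (card C) \<le> real n ^ ((d + 1) * x)"
      using assms(2) by (metis of_nat_le_iff of_nat_power)
    then show ?thesis by (simp add: mult_right_mono del: power_mult_distrib)
  qed
  also have "real n ^ ((d + 1) * x) = exp (real ((d + 1) * x) * ?L)"
    using assms(4) by (subst exp_of_nat_mult) simp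
  also have "\<dots> * exp (- (real x * (real (d + 4) * ?L))) = exp (- (real x * (3 * ?L)))"
    by (simp add: exp_add[symmetric] algebra_simps)
  also have "\<dots> \<le> exp (- (3 * ?L))"
    using assms(3) L mult_right_mono[of 1 "real x" "3 * ?L"] by simp
  also have "\<dots> = 1 / real n ^ 3"
    using assms(4) exp_of_nat_mult[of 3 ?L] by (simp add: exp_minus inverse_eq_divide)
  finally show ?thesis .
qed

section \<open>Expansion properties behind Hall's condition\<close>

text \<open>This interval is kept free until stage \<open>i\<close>; the index after the last stage
  serves the separated set. The length \<open>2 * s\<close> leaves more than \<open>s\<close>
  vertices when fewer than \<open>s\<close> are taken away.\<close>

definition reserve :: "nat \<Rightarrow> nat \<Rightarrow> nat \<Rightarrow> nat set" where
  "reserve b s i = {b + i * (2 * s)..<b + Suc i * (2 * s)}"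

definition start_block :: "nat \<Rightarrow> nat \<Rightarrow> nat set" where
  "start_block k j = {j * k..<Suc j * k}"

definition large_pairs :: "nat \<Rightarrow> nat \<Rightarrow> nat \<Rightarrow> (nat set set \<times> nat set) set" where
  "large_pairs n d s = {(\<D>, Y). small_family n d \<D> \<and> card \<D> = s \<and>
     Y \<subseteq> {..<n} \<and> card Y = s \<and> Y \<inter> \<Union>\<D> = {}}"

text \<open>If at most \<open>x - 1\<close> vertices of a reserve are joined to all of some member
  of \<open>\<D>\<close>, then at least \<open>2 * s + 1 - x\<close> are not; this fixes the size of
  \<open>Y\<close>.\<close>

definition reserve_pairs :: "nat \<Rightarrow> nat \<Rightarrow> nat \<Rightarrow> nat \<Rightarrow> nat \<Rightarrow> nat \<Rightarrow> (nat set set \<times> nat set) set" where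
  "reserve_pairs n d s b i x = {(\<D>, Y). small_family n d \<D> \<and> card \<D> = x \<and>
     Y \<subseteq> reserve b s i \<and> card Y = 2 * s + 1 - x \<and> Y \<inter> \<Union>\<D> = {}}"

text \<open>This is the case of a Hall violator comprising almost all blocks: if
  \<open>M + 1 - y\<close> blocks reach fewer than \<open>M + 1 - y\<close> of \<open>M\<close> free
  vertices, they miss at least \<open>y\<close>.\<close>

definition block_pairs :: "nat \<Rightarrow> nat \<Rightarrow> nat \<Rightarrow> nat \<Rightarrow> (nat set set \<times> nat set) set" where
  "block_pairs n M k y = {(\<D>, Y). \<D> \<subseteq> start_block k ` {..<M} \<and> card \<D> = M + 1 - y \<and>
     Y \<subseteq> {..<n} \<and> card Y = y \<and> Y \<inter> \<Union>\<D> = {}}"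

text \<open>Each clause excludes one kind of violator of Hall's condition. Quantifying over all
  families and sets makes the property independent of the graph being embedded and of the choices
  made on the way.\<close>

definition pseudorandom :: "nat \<Rightarrow> nat \<Rightarrow> nat \<Rightarrow> nat \<Rightarrow> nat \<Rightarrow> nat set set \<Rightarrow> bool" where
  "pseudorandom n d M T s E \<longleftrightarrow>
     (\<forall>(\<D>, Y)\<in>large_pairs n d s. \<not> no_common_nbr E \<D> Y) \<and>
     (\<forall>i\<le>T. \<forall>x\<in>{1..<s}. \<forall>(\<D>, Y)\<in>reserve_pairs n d s (d * M) i x. \<not> no_common_nbr E \<D> Y) \<and>
     (\<forall>k\<in>{1..d}. \<forall>y\<in>{1..s}. \<forall>(\<D>, Y)\<in>block_pairs n M k y. \<not> no_common_nbr E \<D> Y)"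

lemma card_reserve [simp]: "card (reserve b s i) = 2 * s"
  by (simp add: reserve_def)

lemma reserve_disjoint: "i \<noteq> j \<Longrightarrow> reserve b s i \<inter> reserve b s j = {}"
proof (induction i j rule: linorder_wlog)
  case (le i j)
  then have "Suc i * (2 * s) \<le> j * (2 * s)" by (intro mult_right_mono) auto
  then show ?case by (auto simp: reserve_def)
qed blast

lemma reserve_subset:
  assumes "i \<le> T" "b + Suc T * (2 * s) \<le> n"
  shows "reserve b s i \<subseteq> {..<n}"
proof -
  have "Suc i * (2 * s) \<le> Suc T * (2 * s)" using assms(1) by (intro mult_right_mono) auto
  then have "b + Suc i * (2 * s) \<le> n" using assms(2) by linarith
  then show ?thesis unfolding reserve_def by auto
qed

lemma start_block_disjoint: "i \<noteq> j \<Longrightarrow> start_block k i \<inter> start_block k j = {}"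
proof (induction i j rule: linorder_wlog)
  case (le i j)
  then have "Suc i * k \<le> j * k" by (intro mult_right_mono) auto
  then show ?case by (auto simp: start_block_def)
qed blast

lemma UN_start_block: "(\<Union>j<M. start_block k j) = {..<M * k}"
proof (induction M)
  case (Suc M)
  have "(\<Union>j<Suc M. start_block k j) = (\<Union>j<M. start_block k j) \<union> start_block k M"
    by (auto simp: lessThan_Suc)
  also have "\<dots> = {..<M * k} \<union> start_block k M" unfolding Suc ..
  also have "\<dots> = {..<Suc M * k}" by (auto simp: start_block_def)
  finally show ?case .
qed simp

lemma small_family_start_blocks:
  assumes "k \<ge> 1" "k \<le> d" "M * k \<le> n"
  shows "small_family n d (start_block k ` {..<M})"
proof -
  have "start_block k j \<subseteq> {..<n}" if "j < M" for j
  proof -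
    have "start_block k j \<subseteq> {..<M * k}" using that unfolding UN_start_block[symmetric] by blast
    then show ?thesis using assms(3) by auto
  qed
  moreover have "card (start_block k j) = k" "start_block k j \<noteq> {}" for j
    using assms(1) by (auto simp: start_block_def)
  moreover have "pairwise disjnt (start_block k ` {..<M})"
  proof (rule pairwiseI)
    fix A B assume "A \<in> start_block k ` {..<M}" "B \<in> start_block k ` {..<M}" "A \<noteq> B"
    then obtain i j where "A = start_block k i" "B = start_block k j" "i \<noteq> j" by blast
    then show "disjnt A B" using start_block_disjoint by (simp add: disjnt_def)
  qed
  ultimately show ?thesis
    using assms(2) by (auto simp: small_family_def)
qed

lemma card_start_blocks:
  assumes "k \<ge> 1"
  shows "inj_on (start_block k) A" "card (start_block k ` {..<M}) = M"
proof -
  show inj: "inj_on (start_block k) A" for A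
  proof (rule inj_onI)
    fix i j assume "start_block k i = start_block k j"
    moreover have "i * k \<in> start_block k i" using assms by (simp add: start_block_def)
    ultimately show "i = j" using start_block_disjoint[of i j k] by blast
  qed
  show "card (start_block k ` {..<M}) = M" by (simp add: card_image inj)
qed

text \<open>Common form of the three union bounds: at most \<open>n ^ (d * x)\<close> choices for
  the family and at most \<open>n ^ x\<close> for the vertex set.\<close>

lemma prob_pairs_le:
  assumes F: "F \<subseteq> {\<D>. small_family n d \<D>}" "finite F" "card F \<le> n ^ (d * x)"
    and Z: "finite Z" "\<And>Y. Y \<in> Z \<Longrightarrow> Y \<subseteq> {..<n}" "card Z \<le> n ^ x"
    and C: "C \<subseteq> F \<times> Z" "\<And>\<D> Y. (\<D>, Y) \<in> C \<Longrightarrow> Y \<inter> \<Union>\<D> = {} \<and> x * s \<le> card \<D> * card Y"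
    and "x \<ge> 1" "n \<ge> 1" "0 \<le> p" "p \<le> 1"
    and "p ^ d * real s \<ge> real (d + 4) * ln (real n)"
  shows "measure_pmf.prob (random_graph n p) {G. \<exists>(\<D>, Y)\<in>C. no_common_nbr (edges G) \<D> Y}
    \<le> 1 / real n ^ 3"
proof (rule prob_some_no_common_nbr)
  show "finite C" using F(2) Z(1) C(1) finite_subset by blast
  have "card C \<le> card (F \<times> Z)" using F(2) Z(1) C(1) by (intro card_mono) auto
  also have "\<dots> \<le> n ^ (d * x) * n ^ x"
    unfolding card_cartesian_product using F(3) Z(3) by (rule mult_mono) auto
  finally show "card C \<le> n ^ ((d + 1) * x)" by (simp add: power_add mult.commute)
  show "small_family n d \<D> \<and> Y \<subseteq> {..<n} \<and> Y \<inter> \<Union>\<D> = {} \<and> x * s \<le> card \<D> * card Y"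
    if "(\<D>, Y) \<in> C" for \<D> Y
  proof -
    have "\<D> \<in> F" "Y \<in> Z" using that C(1) by auto
    then show ?thesis using F(1) Z(2)[of Y] C(2)[OF that] by blast
  qed
qed (use assms in auto)

lemma prob_UN_le:
  assumes "finite I" "\<And>i. i \<in> I \<Longrightarrow> measure_pmf.prob M (A i) \<le> r"
  shows "measure_pmf.prob M (\<Union>i\<in>I. A i) \<le> real (card I) * r"
proof -
  have "measure_pmf.prob M (\<Union>i\<in>I. A i) \<le> (\<Sum>i\<in>I. measure_pmf.prob M (A i))"
    using assms(1) by (intro measure_pmf.finite_measure_subadditive_finite) auto
  also have "\<dots> \<le> real (card I) * r" using assms(2) by (rule sum_bounded_above)
  finally show ?thesis .
qed

text \<open>The bad events are one for large pairs, at most \<open>Suc T * s\<close> for reserves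
  and at most \<open>d * s\<close> for blocks. Both numbers are at most \<open>n\<close>, and each
  event has probability at most \<open>1 / n ^ 3\<close>.\<close>

lemma prob_pseudorandom:
  assumes d: "d \<ge> 1" and s: "s \<ge> 1" "2 * s \<le> M" and n: "d * M + Suc T * (2 * s) \<le> n"
    and p: "0 \<le> p" "p \<le> 1" and q: "p ^ d * real s \<ge> real (d + 4) * ln (real n)"
  shows "measure_pmf.prob (random_graph n p) {G. pseudorandom n d M T s (edges G)} \<ge> 1 - 3 / real n"
proof -
  let ?P = "measure_pmf.prob (random_graph n p)"
  let ?bad = "\<lambda>C. {G :: nat graph. \<exists>(\<D>, Y)\<in>C. no_common_nbr (edges G) \<D> Y}"
  have n1: "n \<ge> 1" using n s by auto
  have sn: "Suc T * s \<le> n" "d * s \<le> n" "2 * s \<le> n"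
  proof -
    show "Suc T * s \<le> n" using n by simp
    have "d * s \<le> d * M" using s by (intro mult_left_mono) auto
    then show "d * s \<le> n" using n by linarith
    have "1 * (2 * s) \<le> Suc T * (2 * s)" by (rule mult_right_mono) auto
    then show "2 * s \<le> n" using n by simp
  qed
  have large: "?P (?bad (large_pairs n d s)) \<le> 1 / real n ^ 3"
  proof (rule prob_pairs_le)
    show "large_pairs n d s \<subseteq> {\<D>. small_family n d \<D> \<and> card \<D> = s} \<times> {Y. Y \<subseteq> {..<n} \<and> card Y = s}"
      by (auto simp: large_pairs_def)
    show "card {\<D>. small_family n d \<D> \<and> card \<D> = s} \<le> n ^ (d * s)"
      "finite {\<D>. small_family n d \<D> \<and> card \<D> = s}"
      using card_small_families_le[OF d] by auto
    show "card {Y. Y \<subseteq> {..<n} \<and> card Y = s} \<le> n ^ s"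
      by (rule card_subsets_le_power) auto
    show "Y \<inter> \<Union>\<D> = {} \<and> s * s \<le> card \<D> * card Y" if "(\<D>, Y) \<in> large_pairs n d s" for \<D> Y
      using that by (auto simp: large_pairs_def)
  qed (use s n1 p q in auto)
  have reserve: "?P (?bad (reserve_pairs n d s (d * M) i x)) \<le> 1 / real n ^ 3"
    if "(i, x) \<in> {..T} \<times> {1..<s}" for i x
  proof (rule prob_pairs_le)
    let ?Z = "{Y. Y \<subseteq> reserve (d * M) s i \<and> card Y = 2 * s + 1 - x}"
    have fin: "finite (reserve (d * M) s i)" by (simp add: reserve_def)
    have x: "x < s" "1 \<le> x" and i: "i \<le> T" using that by auto
    show "reserve_pairs n d s (d * M) i x \<subseteq> {\<D>. small_family n d \<D> \<and> card \<D> = x} \<times> ?Z"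
      by (auto simp: reserve_pairs_def)
    show "card {\<D>. small_family n d \<D> \<and> card \<D> = x} \<le> n ^ (d * x)"
      "finite {\<D>. small_family n d \<D> \<and> card \<D> = x}"
      using card_small_families_le[OF d] by auto
    have "card ?Z = (2 * s) choose (2 * s + 1 - x)" using fin by (subst n_subsets) auto
    \<comment> \<open>Counting complements: \<open>Y\<close> omits only \<open>x - 1\<close>
      vertices of the reserve, so the choices for \<open>Y\<close> stay within
      \<open>n ^ x\<close>.\<close>
    also have "\<dots> = (2 * s) choose (x - 1)" using x by (subst binomial_symmetric) auto
    also have "\<dots> \<le> (2 * s) ^ (x - 1)" using x by (intro binomial_le_pow) auto
    also have "\<dots> \<le> n ^ (x - 1)" using sn by (intro power_mono) auto
    also have "\<dots> \<le> n ^ x" using n1 by (intro power_increasing) auto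
    finally show "card ?Z \<le> n ^ x" .
    show "finite ?Z" using fin by auto
    show "Y \<subseteq> {..<n}" if "Y \<in> ?Z" for Y using that reserve_subset[OF i n] by blast
    show "Y \<inter> \<Union>\<D> = {} \<and> x * s \<le> card \<D> * card Y"
      if "(\<D>, Y) \<in> reserve_pairs n d s (d * M) i x" for \<D> Y
      using that x by (auto simp: reserve_pairs_def)
    show "1 \<le> x" by (rule x)
  qed (use n1 p q in auto)
  \<comment> \<open>The size \<open>y\<close> of the vertex set drives the union bound here. A
    family omits only \<open>y - 1\<close> of the \<open>M\<close> blocks, and because
    \<open>y \<le> s\<close> and \<open>2 * s \<le> M\<close> it still has more than
    \<open>s\<close> members.\<close>
  have blocks: "?P (?bad (block_pairs n M k y)) \<le> 1 / real n ^ 3"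
    if "(k, y) \<in> {1..d} \<times> {1..s}" for k y
  proof (rule prob_pairs_le)
    let ?F = "{\<D>. \<D> \<subseteq> start_block k ` {..<M} \<and> card \<D> = M + 1 - y}"
    let ?Z = "{Y. Y \<subseteq> {..<n} \<and> card Y = y}"
    have k: "1 \<le> k" "k \<le> d" and y: "1 \<le> y" "y \<le> s" using that by auto
    show "block_pairs n M k y \<subseteq> ?F \<times> ?Z" by (auto simp: block_pairs_def)
    have "M * k \<le> d * M" using k by simp
    also have "\<dots> \<le> n" using n by simp
    finally have Mk: "M * k \<le> n" .
    have Mn: "M \<le> n" using Mk k by (metis le_trans mult_le_mono2 nat_mult_1_right)
    show "?F \<subseteq> {\<D>. small_family n d \<D>}"
      using small_family_subset[OF small_family_start_blocks[OF k Mk]] by blast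
    show "finite ?F" by auto
    have "card ?F = M choose (M + 1 - y)"
      using card_start_blocks(2)[OF k(1)] by (subst n_subsets) auto
    also have "\<dots> = M choose (y - 1)" using y s by (subst binomial_symmetric) auto
    also have "\<dots> \<le> M ^ (y - 1)" using y s by (intro binomial_le_pow) auto
    also have "\<dots> \<le> n ^ (y - 1)" using Mn by (intro power_mono) auto
    also have "\<dots> \<le> n ^ (d * y)"
    proof -
      have "1 * y \<le> d * y" using d by (intro mult_right_mono) auto
      then show ?thesis using n1 by (intro power_increasing) linarith+
    qed
    finally show "card ?F \<le> n ^ (d * y)" .
    show "card ?Z \<le> n ^ y" by (rule card_subsets_le_power) auto
    show "Y \<inter> \<Union>\<D> = {} \<and> y * s \<le> card \<D> * card Y" if "(\<D>, Y) \<in> block_pairs n M k y" for \<D> Y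
      using that y s by (auto simp: block_pairs_def mult.commute[of _ y])
    show "1 \<le> y" by (rule y)
  qed (use n1 p q in auto)
  let ?R = "\<Union>(i, x)\<in>{..T} \<times> {1..<s}. ?bad (reserve_pairs n d s (d * M) i x)"
  let ?B = "\<Union>(k, y)\<in>{1..d} \<times> {1..s}. ?bad (block_pairs n M k y)"
  have "?P ?R \<le> real (card ({..T} \<times> {1..<s})) * (1 / real n ^ 3)"
    using reserve by (intro prob_UN_le) auto
  also have "\<dots> \<le> real n * (1 / real n ^ 3)"
  proof (intro mult_right_mono)
    have "card ({..T} \<times> {1..<s}) \<le> Suc T * s" unfolding card_cartesian_product by (rule mult_mono) auto
    then show "real (card ({..T} \<times> {1..<s})) \<le> real n" using sn(1) by linarith
  qed auto
  finally have R: "?P ?R \<le> real n * (1 / real n ^ 3)" .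
  have "?P ?B \<le> real (card ({1..d} \<times> {1..s})) * (1 / real n ^ 3)"
    using blocks by (intro prob_UN_le) auto
  also have "\<dots> \<le> real n * (1 / real n ^ 3)"
    using sn(2) unfolding card_cartesian_product by (intro mult_right_mono) (simp_all flip: of_nat_mult)
  finally have B: "?P ?B \<le> real n * (1 / real n ^ 3)" .
  have "{G. \<not> pseudorandom n d M T s (edges G)} \<subseteq> ?bad (large_pairs n d s) \<union> ?R \<union> ?B"
    unfolding pseudorandom_def by fastforce
  then have "?P {G. \<not> pseudorandom n d M T s (edges G)} \<le> ?P (?bad (large_pairs n d s) \<union> ?R \<union> ?B)"
    by (intro measure_pmf.finite_measure_mono) auto
  also have "\<dots> \<le> ?P (?bad (large_pairs n d s)) + ?P ?R + ?P ?B"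
    by (intro order.trans[OF measure_Un_le] add_mono order.refl) auto
  also have "\<dots> \<le> 1 / real n ^ 3 + real n * (1 / real n ^ 3) + real n * (1 / real n ^ 3)"
    using large R B by linarith
  also have "\<dots> \<le> 3 / real n"
  proof -
    have "1 \<le> real n" using n1 by simp
    then have "1 \<le> real n ^ 2" "real n \<le> real n ^ 2" by (auto simp: power2_eq_square mult_ge1_I)
    then have "1 + real n + real n \<le> 3 * real n ^ 2" by linarith
    then have "(1 + real n + real n) / real n ^ 3 \<le> 3 * real n ^ 2 / real n ^ 3"
      by (rule divide_right_mono) auto
    also have "\<dots> = 3 / real n" using n1 by (simp add: field_simps power2_eq_square power3_eq_cube)
    finally show ?thesis by (simp add: add_divide_distrib)
  qed
  finally have "?P {G. \<not> pseudorandom n d M T s (edges G)} \<le> 3 / real n" .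
  moreover have "{G :: nat graph. \<not> pseudorandom n d M T s (edges G)} =
    UNIV - {G. pseudorandom n d M T s (edges G)}" by auto
  ultimately show ?thesis
    by (simp add: measure_pmf.prob_compl[simplified])
qed

subsection \<open>Embedding into a pseudorandom graph\<close>

definition embeds :: "('a \<Rightarrow> 'a set) \<Rightarrow> nat set set \<Rightarrow> 'a set \<Rightarrow> ('a \<Rightarrow> nat) \<Rightarrow> bool" where
  "embeds N E U f \<longleftrightarrow> inj_on f U \<and> (\<forall>u\<in>U. \<forall>v\<in>U. v \<in> N u \<longrightarrow> {f u, f v} \<in> E)"

text \<open>The candidates for \<open>w\<close> are the vertices of \<open>F\<close> joined to the
  images of all its embedded neighbours. Hall's theorem selects distinct candidates, and as
  \<open>S\<close> is independent no further edges arise.\<close>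

lemma extend_embedding:
  assumes f: "embeds N E U f" and "S \<inter> U = {}" "finite S" "finite F" "F \<inter> f ` U = {}"
    and sym: "\<And>u v. u \<in> N v \<Longrightarrow> v \<in> N u" and indep: "\<And>u v. u \<in> S \<Longrightarrow> v \<in> S \<Longrightarrow> v \<notin> N u"
    and hall: "\<And>X. X \<subseteq> S \<Longrightarrow> card X \<le> card {v\<in>F. \<exists>w\<in>X. \<forall>u\<in>f ` (N w \<inter> U). {u, v} \<in> E}"
  shows "\<exists>f'. embeds N E (U \<union> S) f' \<and> (\<forall>u\<in>U. f' u = f u) \<and> f' ` S \<subseteq> F"
proof -
  define A where "A w = {v\<in>F. \<forall>u\<in>f ` (N w \<inter> U). {u, v} \<in> E}" for w
  have UN: "\<Union>(A ` X) = {v\<in>F. \<exists>w\<in>X. \<forall>u\<in>f ` (N w \<inter> U). {u, v} \<in> E}" for X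
    by (auto simp: A_def)
  have "\<exists>R. inj_on R S \<and> (\<forall>w\<in>S. R w \<in> A w)"
  proof (rule hall_marriage)
    show "card X \<le> card (\<Union>(A ` X))" if "X \<subseteq> S" for X
      unfolding UN by (rule hall[OF that])
  qed (use \<open>finite S\<close> \<open>finite F\<close> in \<open>auto simp: A_def\<close>)
  then obtain R where R: "inj_on R S" "\<And>w. w \<in> S \<Longrightarrow> R w \<in> A w" by blast
  define f' where "f' u = (if u \<in> S then R u else f u)" for u
  have U: "f' u = f u" if "u \<in> U" for u using that assms(2) by (auto simp: f'_def)
  have S: "f' u = R u" if "u \<in> S" for u using that by (simp add: f'_def)
  have new: "{f u, R w} \<in> E" if "u \<in> U" "w \<in> S" "u \<in> N w" for u w
    using R(2)[OF that(2)] that by (auto simp: A_def)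
  have sub: "f' ` S \<subseteq> F" using R(2) S by (auto simp: A_def)
  have "inj_on f' U" "inj_on f' S"
    using f R(1) U S by (auto simp: embeds_def inj_on_def)
  then have "inj_on f' (U \<union> S)"
    using sub assms(5) U by (subst inj_on_Un) fastforce
  moreover have "{f' u, f' v} \<in> E" if uv: "u \<in> U \<union> S" "v \<in> U \<union> S" "v \<in> N u" for u v
  proof -
    consider "u \<in> U" "v \<in> U" | "u \<in> U" "v \<in> S" | "u \<in> S" "v \<in> U"
      using uv indep by blast
    then show ?thesis
    proof cases
      case 1
      then show ?thesis using f uv(3) U by (auto simp: embeds_def)
    next
      case 2
      then show ?thesis using new[OF 2 sym[OF uv(3)]] U S by simp
    next
      case 3
      then show ?thesis using new[OF 3(2,1) uv(3)] U S by (simp add: insert_commute)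
    qed
  qed
  ultimately show ?thesis using U sub unfolding embeds_def by blast
qed

text \<open>If Hall's condition fails for \<open>X\<close>, fewer than \<open>card X\<close>
  vertices of \<open>F\<close> are candidates, and all others are completely joined to no
  \<open>D w\<close>. Fewer than \<open>s\<close> sets then contradict the reserve clause, and
  \<open>s\<close> or more the clause on large pairs. An empty \<open>D w\<close> makes all of
  \<open>F\<close> candidates.\<close>

lemma hall_from_pseudorandom:
  fixes D :: "'a \<Rightarrow> nat set"
  assumes pr: "pseudorandom n d M T s E" and "finite X"
    and D: "\<And>w. w \<in> X \<Longrightarrow> D w \<subseteq> {..<n} \<and> card (D w) \<le> d \<and> F \<inter> D w = {}"
    and disj: "\<And>w w'. w \<in> X \<Longrightarrow> w' \<in> X \<Longrightarrow> w \<noteq> w' \<Longrightarrow> D w \<inter> D w' = {}"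
    and F: "F \<subseteq> {..<n}" "reserve (d * M) s i \<subseteq> F" "i \<le> T" "card X + s \<le> card F + 1" "s \<ge> 1"
  shows "card X \<le> card {v\<in>F. \<exists>w\<in>X. \<forall>u\<in>D w. {u, v} \<in> E}" (is "_ \<le> card ?Z")
proof (cases "\<exists>w\<in>X. D w = {}")
  case True
  then have "?Z = F" by auto
  then show ?thesis using F(4,5) by simp
next
  case False
  have finF: "finite F" using F(1) finite_subset by blast
  have inj: "inj_on D X"
  proof (rule inj_onI, rule ccontr)
    fix w w' assume "w \<in> X" "w' \<in> X" "D w = D w'" "w \<noteq> w'"
    then show False using disj[of w w'] False by auto
  qed
  have "pairwise disjnt (D ` X)"
  proof (rule pairwiseI)
    fix A B assume "A \<in> D ` X" "B \<in> D ` X" "A \<noteq> B"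
    then obtain w w' where w: "A = D w" "B = D w'" "w \<in> X" "w' \<in> X" "w \<noteq> w'" by blast
    then show "disjnt A B" using disj[OF w(3-5)] by (simp add: disjnt_def)
  qed
  then have fam: "small_family n d (D ` X)"
    using D False by (auto simp: small_family_def)
  have avoid: "Y \<inter> \<Union>\<D> = {}" if "Y \<subseteq> F" "\<D> \<subseteq> D ` X" for Y \<D>
    using that D by blast
  have no: "no_common_nbr E \<D> Y" if "Y \<subseteq> F - ?Z" "\<D> \<subseteq> D ` X" for Y \<D>
    using that unfolding no_common_nbr_def by blast
  show ?thesis
  proof (rule ccontr)
    assume "\<not> ?thesis"
    then have less: "card ?Z < card X" by simp
    have finZ: "finite ?Z" using finF by simp
    show False
    proof (cases "card X < s")
      case True
      \<comment> \<open>At most \<open>card X - 1\<close> vertices of the reserve are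
        candidates.\<close>
      have "2 * s + 1 - card X \<le> 2 * s - card ?Z" using less by linarith
      also have "\<dots> \<le> card (reserve (d * M) s i - ?Z)"
        using diff_card_le_card_Diff[OF finZ, of "reserve (d * M) s i"] by simp
      finally obtain Y where Y: "Y \<subseteq> reserve (d * M) s i - ?Z" "card Y = 2 * s + 1 - card X"
        by (meson obtain_subset_with_card_n)
      have YF: "Y \<subseteq> F - ?Z" using Y(1) F(2) by blast
      have "card X \<in> {1..<s}" using True less by simp
      moreover have "(D ` X, Y) \<in> reserve_pairs n d s (d * M) i (card X)"
        using fam Y avoid[of Y "D ` X"] YF card_image[OF inj] by (auto simp: reserve_pairs_def)
      ultimately have "\<not> no_common_nbr E (D ` X) Y"
        using pr F(3) unfolding pseudorandom_def by blast
      then show False using no[OF YF order.refl] by blast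
    next
      case False
      then obtain \<D> where \<D>: "\<D> \<subseteq> D ` X" "card \<D> = s"
        using card_image[OF inj] by (metis not_less obtain_subset_with_card_n)
      \<comment> \<open>The \<open>+ 1\<close> in the size assumption matches the loss of at most
        \<open>card X - 1\<close> vertices of \<open>F\<close>.\<close>
      have "s \<le> card F - card ?Z" using less F(4) by linarith
      also have "\<dots> \<le> card (F - ?Z)" by (rule diff_card_le_card_Diff[OF finZ])
      finally obtain Y where Y: "Y \<subseteq> F - ?Z" "card Y = s"
        by (meson obtain_subset_with_card_n)
      have "(\<D>, Y) \<in> large_pairs n d s"
        using small_family_subset[OF fam \<D>(1)] \<D> Y avoid[of Y \<D>] F(1)
        by (auto simp: large_pairs_def)
      then have "\<not> no_common_nbr E \<D> Y"
        using pr unfolding pseudorandom_def by blast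
      then show False using no[OF Y(1) \<D>(1)] by blast
    qed
  qed
qed

section \<open>The embedding: boundary, stages, separated set\<close>

context sparse_graph
begin

text \<open>The neighbourhoods of the members of \<open>W\<close> are disjoint and of equal size
  \<open>k\<close>, so each can fill a block of its own. Since the boundary is independent, any
  injection on it is an embedding.\<close>

lemma embed_boundary:
  assumes W: "separated W" "card W = M" "\<And>w. w \<in> W \<Longrightarrow> card (N w) = k"
  shows "\<exists>f \<pi>. embeds N E (\<Union>(N ` W)) f \<and> inj_on \<pi> W \<and> \<pi> ` W = {..<M} \<and>
    (\<forall>w\<in>W. f ` N w = start_block k (\<pi> w))"
proof -
  have "finite W" using W(1) finite_V finite_subset by (auto simp: separated_def)
  then obtain \<pi> where \<pi>: "bij_betw \<pi> W {..<M}"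
    using W(2) by (metis ex_bij_betw_finite_nat atLeast0LessThan)
  have "\<exists>g. bij_betw g (N w) (start_block k (\<pi> w))" if "w \<in> W" for w
    using W(3)[OF that] by (intro finite_same_card_bij) (auto simp: start_block_def)
  then obtain g where g: "\<And>w. w \<in> W \<Longrightarrow> bij_betw (g w) (N w) (start_block k (\<pi> w))" by metis
  \<comment> \<open>\<open>SOME\<close> picks the unique member of \<open>W\<close> adjacent to
    \<open>u\<close>.\<close>
  define f where "f u = g (SOME w. w \<in> W \<and> u \<in> N w) u" for u
  have f: "f u = g w u" if "w \<in> W" "u \<in> N w" for w u
  proof -
    have "(SOME w. w \<in> W \<and> u \<in> N w) = w"
      using that W_disjoint_N[OF W(1)] by (intro some_equality) blast+
    then show ?thesis by (simp add: f_def)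
  qed
  have img: "f ` N w = start_block k (\<pi> w)" if "w \<in> W" for w
  proof -
    have "f ` N w = g w ` N w" using f that by (intro image_cong) auto
    then show ?thesis using g[OF that] by (simp add: bij_betw_def)
  qed
  have "inj_on f (\<Union>(N ` W))"
  proof (rule inj_onI)
    fix u v assume "u \<in> \<Union>(N ` W)" "v \<in> \<Union>(N ` W)" and eq: "f u = f v"
    then obtain w w' where w: "w \<in> W" "u \<in> N w" "w' \<in> W" "v \<in> N w'" by blast
    then have "f u \<in> start_block k (\<pi> w)" "f v \<in> start_block k (\<pi> w')"
      using img by blast+
    then have "\<pi> w = \<pi> w'" using eq start_block_disjoint[of "\<pi> w" "\<pi> w'" k] by (metis disjoint_iff)
    then have "w = w'" using w \<pi> by (auto simp: bij_betw_def inj_on_def)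
    then show "u = v" using eq f w g[OF w(1)] by (auto simp: bij_betw_def inj_on_def)
  qed
  then have "embeds N E (\<Union>(N ` W)) f"
    using boundary_independent[OF W(1)] unfolding embeds_def by blast
  moreover have "inj_on \<pi> W" "\<pi> ` W = {..<M}" using \<pi> by (simp_all add: bij_betw_def)
  ultimately show ?thesis using img by (intro exI[of _ f] exI[of _ \<pi>] conjI ballI)
qed

text \<open>The first fact makes a stage independent; the second makes the embedded neighbourhoods
  of its vertices disjoint.\<close>

lemma separated_2:
  assumes "u \<notin> nball N 2 v"
  shows "u \<notin> N v" "N u \<inter> N v = {}"
proof -
  have ball: "nball N 2 v = nball N (Suc (Suc 0)) v" by (simp add: eval_nat_numeral)
  show "u \<notin> N v" using assms nball_refl[of v N 0] unfolding ball by auto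
  show "N u \<inter> N v = {}"
  proof (rule ccontr)
    assume "N u \<inter> N v \<noteq> {}"
    then obtain x where "x \<in> N v" "u \<in> N x" using sym by blast
    then have "u \<in> nball N (Suc (Suc 0)) v" by auto
    then show False using assms ball by simp
  qed
qed

text \<open>The order is boundary, stages, then \<open>W\<close>. Leaving the \<open>M\<close>
  vertices of \<open>W\<close> for the end keeps at least \<open>M\<close> host vertices free
  throughout, enough for all reserves. The last step is a perfect matching, for which the boundary
  was placed on fixed blocks.\<close>

lemma pseudorandom_embedding:
  assumes n: "card V = n" and pr: "pseudorandom n d M T s E"
    and M: "M * ((d + 1) ^ 2 * (\<Delta> + 1) ^ 6) \<le> n" and s: "(T + 1) * (2 * s) \<le> M" "s \<ge> 1"
    and T: "real n * (1 - 1 / real (2 * (d + 1) * (\<Delta> + 1) ^ 2)) ^ T < 1"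
  shows "\<exists>f. embeds N E V f \<and> f ` V \<subseteq> {..<n}"
proof -
  obtain W k where W: "separated W" "k \<le> d" "card W = M" and deg: "\<And>w. w \<in> W \<Longrightarrow> card (N w) = k"
    using exists_separated M n by blast
  define B where "B = \<Union>(N ` W)"
  define A where "A = V - (W \<union> B)"
  have "real (card A) * (1 - 1 / real (2 * (d + 1) * (\<Delta> + 1) ^ 2)) ^ T \<le>
      real n * (1 - 1 / real (2 * (d + 1) * (\<Delta> + 1) ^ 2)) ^ T"
  proof (intro mult_right_mono zero_le_power)
    show "real (card A) \<le> real n" using finite_V n by (auto simp: A_def intro: card_mono)
    have "2 * (d + 1) * (\<Delta> + 1) ^ 2 \<ge> 1" by (simp add: Suc_le_eq)
    then have "real (2 * (d + 1) * (\<Delta> + 1) ^ 2) \<ge> 1" by (metis of_nat_1 of_nat_le_iff)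
    then show "0 \<le> 1 - 1 / real (2 * (d + 1) * (\<Delta> + 1) ^ 2)" by simp
  qed
  then have small: "real (card A) * (1 - 1 / real (2 * (d + 1) * (\<Delta> + 1) ^ 2)) ^ T < 1"
    using T by linarith
  have "A \<subseteq> V - (W \<union> \<Union>(N ` W))" by (simp add: A_def B_def)
  from exists_stages[OF W(1) this small, folded B_def]
  obtain S where stages: "A = (\<Union>i<T. S i) \<and> (\<forall>i<T. \<forall>j<i. S i \<inter> S j = {}) \<and>
    (\<forall>i<T. \<forall>u\<in>S i. \<forall>v\<in>S i. u \<noteq> v \<longrightarrow> u \<notin> nball N 2 v) \<and>
    (\<forall>i<T. \<forall>v\<in>S i. card (N v \<inter> (B \<union> (\<Union>j<i. S j))) \<le> d)" ..
  note S = stages[THEN conjunct1] stages[THEN conjunct2, THEN conjunct1, rule_format]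
    stages[THEN conjunct2, THEN conjunct2, THEN conjunct1, rule_format]
    stages[THEN conjunct2, THEN conjunct2, THEN conjunct2, rule_format]
  have "\<exists>f0 \<pi>. embeds N E B f0 \<and> inj_on \<pi> W \<and> \<pi> ` W = {..<M} \<and>
    (\<forall>w\<in>W. f0 ` N w = start_block k (\<pi> w))"
    unfolding B_def by (rule embed_boundary[OF W(1,3) deg])
  then obtain f0 \<pi> where init: "embeds N E B f0 \<and> inj_on \<pi> W \<and> \<pi> ` W = {..<M} \<and>
    (\<forall>w\<in>W. f0 ` N w = start_block k (\<pi> w))"
    by (elim exE)
  then have f0: "embeds N E B f0" and \<pi>: "inj_on \<pi> W" "\<pi> ` W = {..<M}"
    and f0_img: "\<And>w. w \<in> W \<Longrightarrow> f0 ` N w = start_block k (\<pi> w)"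
    by simp_all
  have WV: "W \<subseteq> V" using W(1) by (simp add: separated_def)
  have BV: "B \<subseteq> V" unfolding B_def using N_V by blast
  have WB: "W \<inter> B = {}" unfolding B_def by (rule W_disjoint_boundary[OF W(1)])
  have "1 * M \<le> ((d + 1) * (\<Delta> + 1) ^ 6) * M" by (intro mult_right_mono) (simp_all add: Suc_le_eq)
  then have dM: "(d + 1) * M \<le> n"
  proof -
    have "(d + 1) * (1 * M) \<le> (d + 1) * (((d + 1) * (\<Delta> + 1) ^ 6) * M)"
      using \<open>1 * M \<le> _\<close> by (rule mult_le_mono2)
    also have "\<dots> = M * ((d + 1) ^ 2 * (\<Delta> + 1) ^ 6)" by (simp only: power2_eq_square mult_ac)
    finally show ?thesis using M by simp
  qed
  have fit: "d * M + Suc T * (2 * s) \<le> n" using dM s(1) by simp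
  have kM: "M * k \<le> d * M" using W(2) by simp
  define U where "U i = B \<union> (\<Union>j<i. S j)" for i
  define rsv where "rsv i = reserve (d * M) s i" for i
  have rsv_n: "rsv i \<subseteq> {..<n}" if "i \<le> T" for i
    using that fit unfolding rsv_def by (rule reserve_subset)
  have SA: "S i \<subseteq> A" if "i < T" for i using S(1) that by blast
  have UV: "U i \<subseteq> V - W" if "i \<le> T" for i
    unfolding U_def
  proof (intro Un_least UN_least)
    show "B \<subseteq> V - W" using BV WB by blast
    show "S j \<subseteq> V - W" if "j \<in> {..<i}" for j
      using SA[of j] that \<open>i \<le> T\<close> by (auto simp: A_def)
  qed
  \<comment> \<open>Invariant: the reserves of the coming stages and of \<open>W\<close> are
    untouched, and \<open>f\<close> keeps the blocks assigned by \<open>f0\<close>, on which the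
    last step relies.\<close>
  have "\<exists>f. embeds N E (U i) f \<and> f ` U i \<subseteq> {..<n} \<and> (\<forall>j\<in>{i..T}. rsv j \<inter> f ` U i = {}) \<and>
    (\<forall>u\<in>B. f u = f0 u)" if "i \<le> T" for i
    using that
  proof (induction i)
    case 0
    have "f0 ` B = (\<Union>w\<in>W. f0 ` N w)" by (simp add: B_def image_UN)
    also have "\<dots> = (\<Union>w\<in>W. start_block k (\<pi> w))" using f0_img by simp
    also have "\<dots> = (\<Union>j<M. start_block k j)" unfolding \<pi>(2)[symmetric] by simp
    finally have B0: "f0 ` B = {..<M * k}" unfolding UN_start_block .
    have "M * k \<le> n" using kM fit by linarith
    then have "f0 ` B \<subseteq> {..<n}" using B0 by auto
    moreover have "rsv j \<inter> f0 ` B = {}" for j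
    proof -
      have "M * k \<le> x" if "x \<in> rsv j" for x
        using that kM unfolding rsv_def reserve_def atLeastLessThan_iff by linarith
      then show ?thesis unfolding B0 by fastforce
    qed
    ultimately show ?case using f0 by (intro exI[of _ f0]) (simp add: U_def)
  next
    case (Suc i)
    then have i: "i < T" by simp
    obtain f where f: "embeds N E (U i) f" "f ` U i \<subseteq> {..<n}"
      "\<And>j. j \<in> {i..T} \<Longrightarrow> rsv j \<inter> f ` U i = {}" "\<And>u. u \<in> B \<Longrightarrow> f u = f0 u"
      using Suc by auto
    have inj: "inj_on f (U i)" using f(1) by (simp add: embeds_def)
    define later where "later = (\<Union>j\<in>{i<..T}. rsv j)"
    define F where "F = {..<n} - f ` U i - later"
    have SU: "S i \<inter> U i = {}"
    proof -
      have "S i \<inter> B = {}" using SA[OF i] by (auto simp: A_def)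
      moreover have "S i \<inter> (\<Union>j<i. S j) = {}" using S(2)[OF i] by (simp add: Int_UN_distrib)
      ultimately show ?thesis by (simp add: U_def Int_Un_distrib)
    qed
    have Un: "card (U i) + card (S i) + M \<le> n"
    proof -
      have SW: "(U i \<union> S i) \<inter> W = {}" using UV[of i] SA[OF i] i unfolding A_def by auto
      have sub: "U i \<union> S i \<union> W \<subseteq> V" using UV[of i] SA[OF i] i WV unfolding A_def by auto
      then have fin: "finite (U i)" "finite (S i)" "finite W" using finite_V finite_subset by auto
      have "card (U i) + card (S i) + M = card (U i \<union> S i \<union> W)"
        using fin SU SW W(3) by (subst card_Un_disjoint, simp, simp, blast, subst card_Un_disjoint) auto
      also have "\<dots> \<le> n" using sub finite_V n card_mono by blast
      finally show ?thesis .
    qed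
    have later: "card later \<le> T * (2 * s)"
    proof -
      have "card later \<le> (\<Sum>j\<in>{i<..T}. card (rsv j))" unfolding later_def by (rule card_UN_le) simp
      also have "\<dots> = (T - i) * (2 * s)" by (simp add: rsv_def)
      also have "\<dots> \<le> T * (2 * s)" by (rule mult_le_mono1) simp
      finally show ?thesis .
    qed
    have finU: "finite (U i)" using UV[of i] i finite_V finite_subset by fastforce
    have finl: "finite later" by (simp add: later_def rsv_def reserve_def)
    have "n - card (U i) - card later \<le> card F"
    proof -
      have "n - card (U i) \<le> card ({..<n} - f ` U i)"
        using diff_card_le_card_Diff[of "f ` U i" "{..<n}"] finU card_image[OF inj] by simp
      then show ?thesis
        using diff_card_le_card_Diff[OF finl, of "{..<n} - f ` U i"] unfolding F_def by linarith
    qed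
    \<comment> \<open>The \<open>M\<close> places not yet needed for \<open>W\<close> pay for the
      later reserves and for the slack \<open>s\<close> in Hall's condition.\<close>
    moreover have "T * (2 * s) + s \<le> M" using s by simp
    ultimately have cardF: "card (S i) + s \<le> card F" using Un later by linarith
    have finS: "finite (S i)" using SA[OF i] finite_V finite_subset by (auto simp: A_def)
    have "\<exists>f'. embeds N E (U i \<union> S i) f' \<and> (\<forall>u\<in>U i. f' u = f u) \<and> f' ` S i \<subseteq> F"
    proof (rule extend_embedding[OF f(1)])
      show "S i \<inter> U i = {}" by (rule SU)
      show "v \<notin> N u" if "u \<in> S i" "v \<in> S i" for u v
        using S(3)[OF i, of v u] that separated_2(1) N_irrefl by metis
      show "card X \<le> card {v \<in> F. \<exists>w\<in>X. \<forall>u\<in>f ` (N w \<inter> U i). {u, v} \<in> E}" if X: "X \<subseteq> S i" for X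
      proof (rule hall_from_pseudorandom[OF pr])
        show "finite X" using X finS finite_subset by blast
        show "f ` (N w \<inter> U i) \<subseteq> {..<n} \<and> card (f ` (N w \<inter> U i)) \<le> d \<and> F \<inter> f ` (N w \<inter> U i) = {}"
          if "w \<in> X" for w
        proof (intro conjI)
          have "card (f ` (N w \<inter> U i)) \<le> card (N w \<inter> U i)" by (rule card_image_le) simp
          also have "\<dots> \<le> d" using S(4)[OF i, of w] that X unfolding U_def by blast
          finally show "card (f ` (N w \<inter> U i)) \<le> d" .
        qed (use f(2) in \<open>auto simp: F_def\<close>)
        show "f ` (N w \<inter> U i) \<inter> f ` (N w' \<inter> U i) = {}" if "w \<in> X" "w' \<in> X" "w \<noteq> w'" for w w'
        proof -
          have "N w \<inter> N w' = {}" using S(3)[OF i, of w w'] that X by (intro separated_2(2)) blast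
          then show ?thesis
            using inj_on_image_Int[OF inj, of "N w \<inter> U i" "N w' \<inter> U i"] by auto
        qed
        show "F \<subseteq> {..<n}" by (auto simp: F_def)
        show "reserve (d * M) s i \<subseteq> F"
        proof -
          have "rsv i \<inter> f ` U i = {}" using f(3)[of i] i by simp
          moreover have "rsv i \<inter> later = {}"
            using reserve_disjoint[of i _ "d * M" s] unfolding later_def rsv_def Int_UN_distrib by simp
          ultimately show ?thesis using rsv_n[of i] i unfolding F_def rsv_def by auto
        qed
        have "card X \<le> card (S i)" using X finS by (rule card_mono[rotated])
        then show "card X + s \<le> card F + 1" using cardF by linarith
      qed (use i s in auto)
    qed (use finS sym in \<open>auto simp: F_def\<close>)
    then obtain f' where f': "embeds N E (U i \<union> S i) f'" "\<And>u. u \<in> U i \<Longrightarrow> f' u = f u"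
      "f' ` S i \<subseteq> F" by blast
    have U_Suc: "U (Suc i) = U i \<union> S i" by (auto simp: U_def lessThan_Suc)
    have img: "f' ` U (Suc i) = f ` U i \<union> f' ` S i"
    proof -
      have "f' ` U i = f ` U i" by (rule image_cong) (simp_all add: f'(2))
      then show ?thesis by (simp add: U_Suc image_Un)
    qed
    show ?case
    proof (intro exI[of _ f'] conjI ballI)
      show "embeds N E (U (Suc i)) f'" using f'(1) by (simp add: U_Suc)
      show "f' ` U (Suc i) \<subseteq> {..<n}" using f(2) f'(3) unfolding img by (auto simp: F_def)
      show "rsv j \<inter> f' ` U (Suc i) = {}" if "j \<in> {Suc i..T}" for j
      proof -
        have "rsv j \<subseteq> later" using that unfolding later_def by (intro UN_upper) auto
        then have "rsv j \<inter> f' ` S i = {}" using f'(3) unfolding F_def by blast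
        moreover have "rsv j \<inter> f ` U i = {}" using f(3)[of j] that by simp
        ultimately show ?thesis unfolding img by blast
      qed
      show "f' u = f0 u" if "u \<in> B" for u
        using f(4)[OF that] f'(2)[of u] that by (auto simp: U_def)
    qed
  qed
  from this[OF order.refl] obtain f where f: "embeds N E (U T) f" "f ` U T \<subseteq> {..<n}"
    "rsv T \<inter> f ` U T = {}" "\<And>u. u \<in> B \<Longrightarrow> f u = f0 u" by auto
  have inj: "inj_on f (U T)" using f(1) by (simp add: embeds_def)
  have UT: "U T = V - W" using S(1) BV WB by (auto simp: U_def A_def)
  have finW: "finite W" using WV finite_V finite_subset by blast
  \<comment> \<open>Exactly \<open>M\<close> vertices remain for the \<open>M\<close> vertices of
    \<open>W\<close>, so no slack is left.\<close>
  define F where "F = {..<n} - f ` U T"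
  have cardF: "card F = M"
  proof -
    have "card F = n - card (f ` U T)"
      unfolding F_def using f(2) by (subst card_Diff_subset) (auto intro: finite_subset)
    also have "\<dots> = n - (n - M)"
      using card_image[OF inj] WV finW n W(3) by (simp add: UT card_Diff_subset)
    also have "\<dots> = M" using dM by simp
    finally show ?thesis .
  qed
  have "\<exists>f'. embeds N E (U T \<union> W) f' \<and> (\<forall>u\<in>U T. f' u = f u) \<and> f' ` W \<subseteq> F"
  proof (rule extend_embedding[OF f(1)])
    have block: "f ` (N w \<inter> U T) = start_block k (\<pi> w)" if "w \<in> W" for w
    proof -
      have "N w \<subseteq> B" using that by (auto simp: B_def)
      then have "N w \<inter> U T = N w" by (auto simp: U_def)
      moreover have "f ` N w = f0 ` N w" using f(4) \<open>N w \<subseteq> B\<close> by (intro image_cong) auto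
      ultimately show ?thesis using f0_img[OF that] by simp
    qed
    show "v \<notin> N u" if "u \<in> W" "v \<in> W" for u v
      using that WB unfolding B_def by blast
    show "card X \<le> card {v \<in> F. \<exists>w\<in>X. \<forall>u\<in>f ` (N w \<inter> U T). {u, v} \<in> E}" (is "_ \<le> card ?Z")
      if X: "X \<subseteq> W" for X
    proof (cases "card X + s \<le> card F + 1")
      case True
      show ?thesis
      proof (rule hall_from_pseudorandom[OF pr])
        show "finite X" using X finW finite_subset by blast
        show "f ` (N w \<inter> U T) \<subseteq> {..<n} \<and> card (f ` (N w \<inter> U T)) \<le> d \<and> F \<inter> f ` (N w \<inter> U T) = {}"
          if "w \<in> X" for w
        proof (intro conjI)
          show "card (f ` (N w \<inter> U T)) \<le> d"
            using block[of w] that X W(2) by (auto simp: start_block_def)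
        qed (use f(2) in \<open>auto simp: F_def\<close>)
        show "f ` (N w \<inter> U T) \<inter> f ` (N w' \<inter> U T) = {}" if "w \<in> X" "w' \<in> X" "w \<noteq> w'" for w w'
        proof -
          have "\<pi> w \<noteq> \<pi> w'" using that X \<pi>(1) by (auto simp: inj_on_def)
          have mem: "w \<in> W" "w' \<in> W" using that X by blast+
          show ?thesis
            unfolding block[OF mem(1)] block[OF mem(2)]
            using \<open>\<pi> w \<noteq> \<pi> w'\<close> by (rule start_block_disjoint)
        qed
        show "F \<subseteq> {..<n}" by (auto simp: F_def)
        show "reserve (d * M) s T \<subseteq> F" using f(3) rsv_n[of T] unfolding F_def rsv_def by auto
      qed (use True s in auto)
    next
      \<comment> \<open>Now \<open>X\<close> is almost all of \<open>W\<close>, and the blocks of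
        its vertices are almost all of the \<open>M\<close> blocks.\<close>
      case False
      have Xle: "card X \<le> M" using X finW W(3) card_mono by blast
      have X0: "X \<noteq> {}" using False cardF s by auto
      show ?thesis
      proof (cases "k = 0")
        \<comment> \<open>Vertices without neighbours can go to any free place.\<close>
        case True
        then have "?Z = F" using X0 X block by (auto simp: start_block_def)
        then show ?thesis using cardF Xle by simp
      next
        case k: False
        show ?thesis
        proof (rule ccontr)
          assume "\<not> ?thesis"
          then have less: "card ?Z < card X" by simp
          \<comment> \<open>At most \<open>card X - 1\<close> of the \<open>M\<close> free vertices
            are candidates, so at least \<open>y\<close> are missed by all blocks of
            \<open>X\<close>.\<close>
          define y where "y = M + 1 - card X"
          define \<D> where "\<D> = start_block k ` (\<pi> ` X)"
          have "y \<le> card F - card ?Z" unfolding y_def using less cardF by linarith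
          also have "\<dots> \<le> card (F - ?Z)"
            by (rule diff_card_le_card_Diff) (simp add: F_def)
          finally obtain Y where Y: "Y \<subseteq> F - ?Z" "card Y = y" by (meson obtain_subset_with_card_n)
          have y: "y \<in> {1..s}" using False cardF Xle by (auto simp: y_def)
          have "card \<D> = card X"
            unfolding \<D>_def using card_image[OF card_start_blocks(1)] k inj_on_subset[OF \<pi>(1) X]
            by (simp add: card_image)
          moreover have "\<D> \<subseteq> start_block k ` {..<M}"
            using X \<pi>(2) unfolding \<D>_def by blast
          moreover have "Y \<inter> \<Union>\<D> = {}"
          proof -
            have "D \<subseteq> f ` U T" if "D \<in> \<D>" for D
              using that block X unfolding \<D>_def by blast
            then show ?thesis using Y(1) unfolding F_def by blast
          qed
          moreover have "Y \<subseteq> {..<n}" using Y(1) by (auto simp: F_def)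
          ultimately have "(\<D>, Y) \<in> block_pairs n M k y"
            using Y(2) Xle by (simp add: block_pairs_def y_def)
          then have "\<not> no_common_nbr E \<D> Y"
            using pr y k W(2) unfolding pseudorandom_def by fastforce
          moreover have "no_common_nbr E \<D> Y"
            unfolding no_common_nbr_def
          proof (intro ballI)
            fix D v assume "D \<in> \<D>" "v \<in> Y"
            then obtain w where w: "w \<in> X" "D = start_block k (\<pi> w)" unfolding \<D>_def by blast
            then have "D = f ` (N w \<inter> U T)" using block X by auto
            then show "\<exists>u\<in>D. {u, v} \<notin> E" using w(1) \<open>v \<in> Y\<close> Y(1) by blast
          qed
          ultimately show False by blast
        qed
      qed
    qed
    show "W \<inter> U T = {}" by (simp add: UT Diff_Int_distrib)
  qed (use finW sym in \<open>auto simp: F_def\<close>)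
  then obtain f' where f': "embeds N E (U T \<union> W) f'" "\<And>u. u \<in> U T \<Longrightarrow> f' u = f u" "f' ` W \<subseteq> F"
    by blast
  have V: "U T \<union> W = V" using UT WV by blast
  have "f' ` U T = f ` U T" by (rule image_cong) (simp_all add: f'(2))
  then have "f' ` V = f ` U T \<union> f' ` W" unfolding V[symmetric] image_Un by simp
  then have "f' ` V \<subseteq> {..<n}" using f(2) f'(3) unfolding F_def by auto
  then show ?thesis using f'(1) V by auto
qed

end

section \<open>From the graph family to neighbourhood functions\<close>

text \<open>Handshake lemma: both sides count incidences between vertices and edges.\<close>

lemma sum_degree_eq:
  assumes "finite U" "E \<subseteq> [U]\<^bsup>2\<^esup>"
  shows "(\<Sum>u\<in>U. card {v. {u, v} \<in> E}) = 2 * card E"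
proof -
  have finE: "finite E" using assms finite_imp_finite_nsets finite_subset by blast
  have "card {v. {u, v} \<in> E} = (\<Sum>e\<in>E. of_bool (u \<in> e))" for u
  proof -
    have "bij_betw (\<lambda>v. {u, v}) {v. {u, v} \<in> E} {e \<in> E. u \<in> e}"
    proof (rule bij_betwI')
      show "\<exists>v\<in>{v. {u, v} \<in> E}. e = {u, v}" if "e \<in> {e \<in> E. u \<in> e}" for e
      proof -
        have "e \<in> [U]\<^bsup>2\<^esup>" using that assms(2) by blast
        then obtain x y where e: "e = {x, y}" by (rule nsets2_E)
        then have "e = {u, if u = x then y else x}" using that by auto
        then show ?thesis using that by auto
      qed
    qed (auto simp: doubleton_eq_iff)
    then have "card {v. {u, v} \<in> E} = card {e \<in> E. u \<in> e}" by (rule bij_betw_same_card)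
    then show ?thesis using finE by (simp add: Int_def)
  qed
  then have "(\<Sum>u\<in>U. card {v. {u, v} \<in> E}) = (\<Sum>e\<in>E. \<Sum>u\<in>U. of_bool (u \<in> e))"
    by (simp add: sum.swap[of _ U])
  also have "\<dots> = (\<Sum>e\<in>E. 2)"
  proof (rule sum.cong)
    fix e assume "e \<in> E"
    then have "e \<subseteq> U" "card e = 2" using assms(2) by (auto simp: nsets_def)
    then show "(\<Sum>u\<in>U. of_bool (u \<in> e)) = (2 :: nat)"
      using assms(1) by (simp add: Int_absorb1)
  qed simp
  finally show ?thesis by simp
qed

text \<open>The density bound for \<open>U\<close> comes from the subgraph formed by
  \<open>U\<close> and all edges inside it. Each excluded closed walk on distinct vertices is a
  \<open>cycle\<close> shorter than 7.\<close>

lemma sparse_graph_if_family: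
  assumes H: "H \<in> graph_family n \<Delta> (real d) 7" and "d \<ge> 1" and "n \<ge> 1"
  shows "sparse_graph (verts H) (\<lambda>v. {u. {v, u} \<in> edges H}) \<Delta> d"
proof -
  let ?N = "\<lambda>v. {u. {v, u} \<in> edges H}"
  have fin: "finite (verts H)" and E: "edges H \<subseteq> [verts H]\<^bsup>2\<^esup>" and ne: "verts H \<noteq> {}"
    and deg: "max_degree H \<le> \<Delta>" and dens: "max_density H \<le> real d" and girth: "girth H \<ge> 7"
    using assms by (auto simp: graph_family_def simple_graph_def)
  have edge: "u \<in> verts H \<and> v \<in> verts H \<and> u \<noteq> v" if "{u, v} \<in> edges H" for u v
    using that E by (metis doubleton_in_nsets_2 subsetD)
  have finE: "finite (edges H)" using E fin finite_imp_finite_nsets finite_subset by blast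
  have cyc: "length c \<ge> 7" if "cycle H c" for c
  proof -
    have "7 \<le> enat (length c)"
      using girth that unfolding girth_def by (meson INF_lower mem_Collect_eq order_trans)
    then show ?thesis by (simp add: numeral_eq_enat)
  qed
  show ?thesis
  proof
    show "u \<in> verts H" if "u \<in> ?N v" for u v using edge that by auto
    show "v \<in> ?N u" if "u \<in> ?N v" for u v using that by (simp add: insert_commute)
    show "card (?N v) \<le> \<Delta>" for v
    proof (cases "v \<in> verts H")
      case True
      have "card (?N v) \<le> degree H v"
        unfolding degree_def using finE
        by (intro card_inj_on_le[of "\<lambda>u. {v, u}"]) (auto simp: inj_on_def doubleton_eq_iff)
      also have "\<dots> \<le> max_degree H" unfolding max_degree_def using True fin by (intro Max_ge) auto
      finally show ?thesis using deg by simp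
    next
      case False
      then have "?N v = {}" using edge by blast
      then show ?thesis by simp
    qed
    show "(\<Sum>u\<in>U. card (?N u \<inter> U)) \<le> d * card U" if U: "U \<subseteq> verts H" for U
    proof (cases "U = {}")
      case False
      define E' where "E' = edges H \<inter> [U]\<^bsup>2\<^esup>"
      let ?D = "\<lambda>H' :: nat graph. 2 * real (card (edges H')) / real (card (verts H'))"
      have finU: "finite U" using U fin finite_subset by blast
      have "?N u \<inter> U = {v. {u, v} \<in> E'}" if "u \<in> U" for u
        using that edge by (auto simp: E'_def)
      then have "(\<Sum>u\<in>U. card (?N u \<inter> U)) = (\<Sum>u\<in>U. card {v. {u, v} \<in> E'})" by simp
      also have "\<dots> = 2 * card E'" using finU by (intro sum_degree_eq) (auto simp: E'_def)
      finally have sum: "(\<Sum>u\<in>U. card (?N u \<inter> U)) = 2 * card E'" .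
      have sub: "subgraph (U, E') H"
        using finU U by (auto simp: subgraph_def simple_graph_def E'_def)
      have "{H'. subgraph H' H} \<subseteq> Pow (verts H) \<times> Pow (edges H)"
        by (auto simp: subgraph_def)
      then have "finite {H'. subgraph H' H}" using fin finE finite_subset by blast
      then have "finite (?D ` {H'. subgraph H' H})" by (rule finite_imageI)
      then have "finite {?D H' | H'. subgraph H' H \<and> verts H' \<noteq> {}}"
        by (rule rev_finite_subset) blast
      moreover have "?D (U, E') \<in> {?D H' | H'. subgraph H' H \<and> verts H' \<noteq> {}}"
        using sub False by force
      ultimately have "?D (U, E') \<le> max_density H" unfolding max_density_def by (rule Max_ge)
      then have "2 * real (card E') / real (card U) \<le> real d" using dens by simp
      moreover have "real (card U) > 0" using False finU by (simp add: card_gt_0_iff)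
      ultimately have "2 * real (card E') \<le> real d * real (card U)" by (simp add: pos_divide_le_eq)
      then have "2 * card E' \<le> d * card U" by (simp flip: of_nat_mult of_nat_le_iff)
      then show ?thesis using sum by simp
    qed simp
    show False if "b \<in> ?N a" "c \<in> ?N b" "a \<in> ?N c" for a b c
    proof -
      have "cycle H [a, b, c]" using that edge[of a b] edge[of b c] edge[of c a]
        by (auto simp: cycle_def less_Suc_eq)
      then show False using cyc by fastforce
    qed
    show "a = c \<or> b = x" if "b \<in> ?N a" "c \<in> ?N b" "x \<in> ?N c" "a \<in> ?N x" for a b c x
    proof (rule ccontr)
      assume "\<not> ?thesis"
      then have "cycle H [a, b, c, x]" using that edge[of a b] edge[of b c] edge[of c x] edge[of x a]
        by (auto simp: cycle_def less_Suc_eq)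
      then show False using cyc by fastforce
    qed
    show "\<not> distinct [a, b, c, x, y]"
      if "b \<in> ?N a" "c \<in> ?N b" "x \<in> ?N c" "y \<in> ?N x" "a \<in> ?N y" for a b c x y
    proof
      assume "distinct [a, b, c, x, y]"
      then have "cycle H [a, b, c, x, y]" using that by (auto simp: cycle_def less_Suc_eq)
      then show False using cyc by fastforce
    qed
    show "\<not> distinct [a, b, c, x, y, z]"
      if "b \<in> ?N a" "c \<in> ?N b" "x \<in> ?N c" "y \<in> ?N x" "z \<in> ?N y" "a \<in> ?N z" for a b c x y z
    proof
      assume "distinct [a, b, c, x, y, z]"
      then have "cycle H [a, b, c, x, y, z]" using that by (auto simp: cycle_def less_Suc_eq)
      then show False using cyc by fastforce
    qed
  qed (use fin assms in auto)
qed

text \<open>An embedding of \<open>n\<close> vertices into \<open>{..<n}\<close> is onto, so the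
  image of \<open>H\<close> is a subgraph on the full vertex set of \<open>G\<close>.\<close>

lemma universal_if_pseudorandom:
  assumes G: "verts G = {..<n}" and pr: "pseudorandom n d M T s (edges G)"
    and "M * ((d + 1) ^ 2 * (\<Delta> + 1) ^ 6) \<le> n" "(T + 1) * (2 * s) \<le> M" "s \<ge> 1"
    and "real n * (1 - 1 / real (2 * (d + 1) * (\<Delta> + 1) ^ 2)) ^ T < 1"
    and "d \<ge> 1" "n \<ge> 1"
  shows "universal G (graph_family n \<Delta> (real d) 7)"
  unfolding universal_def
proof
  fix H assume H: "H \<in> graph_family n \<Delta> (real d) 7"
  let ?N = "\<lambda>v. {u. {v, u} \<in> edges H}"
  interpret sparse_graph "verts H" ?N \<Delta> d
    using H assms(7,8) by (rule sparse_graph_if_family)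
  have cardV: "card (verts H) = n" and E: "edges H \<subseteq> [verts H]\<^bsup>2\<^esup>"
    using H by (auto simp: graph_family_def simple_graph_def)
  obtain f where f: "embeds ?N (edges G) (verts H) f" "f ` verts H \<subseteq> {..<n}"
    using pseudorandom_embedding[OF cardV pr assms(3-6)] by blast
  have inj: "inj_on f (verts H)" using f(1) by (simp add: embeds_def)
  have "card (f ` verts H) = card {..<n}" using card_image[OF inj] cardV by simp
  then have img: "f ` verts H = {..<n}" using f(2) by (intro card_subset_eq) auto
  let ?H' = "({..<n}, (\<lambda>e. f ` e) ` edges H)"
  have edge: "f ` e \<in> [{..<n}]\<^bsup>2\<^esup> \<and> f ` e \<in> edges G" if "e \<in> edges H" for e
  proof -
    obtain u v where uv: "e = {u, v}" "u \<in> verts H" "v \<in> verts H" "u \<noteq> v"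
      using E \<open>e \<in> edges H\<close> by (meson nsets2_E subsetD)
    have "f u \<noteq> f v" using inj uv by (auto simp: inj_on_def)
    moreover have "{f u, f v} \<in> edges G" using f(1) uv \<open>e \<in> edges H\<close> by (auto simp: embeds_def)
    ultimately show ?thesis using uv f(2) by auto
  qed
  have "subgraph ?H' G" using edge G by (auto simp: subgraph_def simple_graph_def)
  moreover have "isomorphic H ?H'"
    unfolding isomorphic_def using inj img by (auto simp: bij_betw_def intro!: exI[of _ f])
  ultimately show "\<exists>H'. subgraph H' G \<and> isomorphic H H'" by blast
qed

subsection \<open>Choice of the parameters\<close>

text \<open>Since \<open>1 - 1 / c \<le> exp (- (1 / c))\<close>, the left side is at most n exp (-
  T / c).\<close>

lemma stages_exhaust:
  fixes c :: real
  assumes "c \<ge> 1" "n \<ge> 1" and T: "real T > c * ln (real n)"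
  shows "real n * (1 - 1 / c) ^ T < 1"
proof -
  have "(1 - 1 / c) ^ T \<le> exp (- (1 / c)) ^ T"
    using assms(1) exp_ge_add_one_self[of "- (1 / c)"] by (intro power_mono) auto
  also have "\<dots> = exp (- (real T / c))" by (simp add: exp_of_nat_mult[symmetric])
  also have "\<dots> < exp (- ln (real n))"
    using T assms(1) by (simp add: pos_less_divide_eq mult.commute)
  also have "\<dots> = 1 / real n" using assms(2) by (simp add: exp_minus inverse_eq_divide)
  finally show ?thesis using assms(2) by (simp add: field_simps)
qed

text \<open>The power \<open>d\<close> turns \<open>n powr (- 1 / d)\<close> into
  \<open>1 / n\<close>. The exponents kept are those that the parameters consume: 8 is 6 for the
  separated set plus 2 for the number of stages, and one logarithm each goes to the number of stages
  and to the size of the reserves.\<close>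

lemma power_ge_of_ratio:
  fixes p K :: real
  assumes "n \<ge> 1" "d \<ge> 1" "\<Delta> > 1" "K \<ge> 0" and L: "ln (real n) \<ge> 1"
    and p: "p \<ge> K * (real \<Delta> ^ 12 * real n powr (- 1 / real d) * ln (real n) ^ 3)"
  shows "real n * p ^ d \<ge> K ^ d * (real \<Delta> ^ 8 * ln (real n) ^ 2)"
proof -
  let ?L = "ln (real n)"
  have "(real n powr (- 1 / real d)) ^ d = real n powr (- 1)"
    using assms(1,2) by (simp add: powr_realpow[symmetric] powr_powr)
  also have "\<dots> = 1 / real n" using assms(1) by (simp add: powr_minus inverse_eq_divide)
  finally have pw: "(real n powr (- 1 / real d)) ^ d = 1 / real n" .
  have "real \<Delta> ^ 8 * ?L ^ 2 \<le> real \<Delta> ^ (12 * d) * ?L ^ (3 * d)"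
    using assms(2,3) L by (intro mult_mono power_increasing) auto
  then have "K ^ d * (real \<Delta> ^ 8 * ?L ^ 2) \<le> K ^ d * (real \<Delta> ^ (12 * d) * ?L ^ (3 * d))"
    using assms(4) by (intro mult_left_mono) auto
  also have "\<dots> = real n * (K * (real \<Delta> ^ 12 * real n powr (- 1 / real d) * ?L ^ 3)) ^ d"
    using assms(1) by (simp only: power_mult_distrib pw power_mult) simp
  also have "\<dots> \<le> real n * p ^ d"
    using p assms L by (intro mult_left_mono power_mono) auto
  finally show ?thesis .
qed

text \<open>The constant comes from \<open>d + 1 \<le> 2 ^ d\<close>, \<open>d + 4 \<le> 5 * 2 ^ d\<close> and
  \<open>(\<Delta> + 1) ^ 8 \<le> 26 * \<Delta> ^ 8\<close>: it is \<open>16 * 5 * 26 * 2 ^ 4\<close>.\<close>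

lemma parameters_exist:
  fixes p :: real
  assumes "d \<ge> 1" "\<Delta> > 1" "0 \<le> p" "p \<le> 1" and L: "ln (real n) \<ge> 1" and n: "n \<ge> 1"
    and p: "p \<ge> 33280 * (real \<Delta> ^ 12 * real n powr (- 1 / real d) * ln (real n) ^ 3)"
  shows "\<exists>M T s. s \<ge> 1 \<and> (T + 1) * (2 * s) \<le> M \<and> M * ((d + 1) ^ 2 * (\<Delta> + 1) ^ 6) \<le> n \<and>
    real n * (1 - 1 / real (2 * (d + 1) * (\<Delta> + 1) ^ 2)) ^ T < 1 \<and>
    p ^ d * real s \<ge> real (d + 4) * ln (real n)"
proof -
  let ?L = "ln (real n)" and ?c = "2 * (d + 1) * (\<Delta> + 1) ^ 2" and ?b = "(d + 1) ^ 2 * (\<Delta> + 1) ^ 6"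
  let ?q = "p ^ d"
  have "2 * 1 \<le> ?c" unfolding mult.assoc by (rule mult_left_mono) (simp_all add: Suc_le_eq)
  then have c: "real ?c \<ge> 2" by linarith
  have b: "?b > 0" by simp
  have big: "real n * ?q \<ge> 33280 ^ d * (real \<Delta> ^ 8 * ?L ^ 2)"
    using assms by (intro power_ge_of_ratio) auto
  have "33280 ^ d * (real \<Delta> ^ 8 * ?L ^ 2) > 0" using assms(2) L by simp
  then have "real n * ?q > 0" using big by linarith
  then have q: "?q > 0" by (simp add: zero_less_mult_iff)
  have q1: "?q \<le> 1" using assms(3,4) by (rule power_le_one)
  \<comment> \<open>\<open>T\<close> just exceeds the number of rounds that exhaust all vertices,
    \<open>s\<close> is the least size that beats the union bound, and \<open>M\<close> is the
    largest size guaranteed for a separated set.\<close>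
  define T where "T = nat \<lfloor>real ?c * ?L\<rfloor> + 1"
  define s where "s = nat \<lceil>real (d + 4) * ?L / ?q\<rceil>"
  define M where "M = n div ?b"
  have cL: "real ?c * ?L \<ge> 2" using mult_mono[OF c L] by simp
  have T: "real T > real ?c * ?L" "real T + 1 \<le> 2 * (real ?c * ?L)"
    using cL unfolding T_def by linarith+
  have dL: "real (d + 4) * ?L \<ge> 1" using mult_mono[of 1 "real (d + 4)" 1 ?L] L by simp
  then have "real (d + 4) * ?L / ?q \<ge> 1" using q q1 by (simp add: pos_le_divide_eq)
  then have s: "s \<ge> 1" "real s \<ge> real (d + 4) * ?L / ?q" "real s \<le> 2 * (real (d + 4) * ?L / ?q)"
  proof -
    have "nat \<lceil>x\<rceil> \<ge> 1 \<and> real (nat \<lceil>x\<rceil>) \<ge> x \<and> real (nat \<lceil>x\<rceil>) \<le> 2 * x" if "x \<ge> 1" for x :: real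
      using that by linarith
    then show "s \<ge> 1" "real s \<ge> real (d + 4) * ?L / ?q" "real s \<le> 2 * (real (d + 4) * ?L / ?q)"
      using \<open>real (d + 4) * ?L / ?q \<ge> 1\<close> unfolding s_def by blast+
  qed
  have d2: "real (d + 1) \<le> 2 ^ d" "real (d + 4) \<le> 5 * 2 ^ d"
  proof -
    have "d + 1 \<le> 2 ^ d" by (simp add: Suc_le_eq)
    then have "real (d + 1) \<le> real (2 ^ d)" by (simp only: of_nat_le_iff)
    then show "real (d + 1) \<le> 2 ^ d" by simp
    then show "real (d + 4) \<le> 5 * 2 ^ d" using assms(1) by simp
  qed
  \<comment> \<open>The factor 3 / 2 comes from \<open>\<Delta> \<ge> 2\<close>.\<close>
  have "real (\<Delta> + 1) ^ 8 \<le> (3 / 2 * real \<Delta>) ^ 8" using assms(2) by (intro power_mono) auto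
  also have "\<dots> = (6561 / 256) * real \<Delta> ^ 8" by (simp add: power_mult_distrib power_divide)
  also have "\<dots> \<le> 26 * real \<Delta> ^ 8" by (intro mult_right_mono) auto
  finally have X: "real (\<Delta> + 1) ^ 8 \<le> 26 * real \<Delta> ^ 8" .
  \<comment> \<open>All size constraints reduce to this product being at most \<open>n\<close>; the
    lower bound \<open>big\<close> absorbs the division by \<open>?q\<close>.\<close>
  have "real ((T + 1) * (2 * s) * ?b) = 2 * (real T + 1) * real s * real ?b"
    by (simp only: of_nat_mult of_nat_add of_nat_1 of_nat_numeral mult_ac)
  also have "\<dots> \<le> 2 * (2 * (real ?c * ?L)) * (2 * (real (d + 4) * ?L / ?q)) * real ?b"
    using T(2) s(3) cL L q by (intro mult_mono) auto
  \<comment> \<open>The factor 16 collects the 2 in \<open>2 * s\<close>, the 2 in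
    \<open>?c\<close>, and one 2 each from rounding \<open>T\<close> and \<open>s\<close>.\<close>
  also have "\<dots> = 16 * (real (d + 1) ^ 3 * real (d + 4)) * real (\<Delta> + 1) ^ 8 * ?L ^ 2 / ?q"
  proof -
    have "2 * (2 * (2 * a * x ^ 2 * l)) * (2 * (e * l / q)) * (a ^ 2 * x ^ 6) =
      16 * (a ^ 3 * e) * x ^ 8 * l ^ 2 / q" for a e x l q :: real
      by (simp add: eval_nat_numeral)
    then show ?thesis unfolding of_nat_mult of_nat_power of_nat_numeral .
  qed
  also have "\<dots> \<le> 16 * ((2 ^ d) ^ 3 * (5 * 2 ^ d)) * (26 * real \<Delta> ^ 8) * ?L ^ 2 / ?q"
    using d2 X q L by (intro divide_right_mono mult_mono power_mono) auto
  also have "\<dots> = 2080 * 16 ^ d * (real \<Delta> ^ 8 * ?L ^ 2) / ?q"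
  proof -
    have "(2 ^ d) ^ 3 = (8 :: real) ^ d"
      by (simp add: power_mult[symmetric] mult.commute[of d] power_mult)
    moreover have "8 ^ d * 2 ^ d = (16 :: real) ^ d" by (simp flip: power_mult_distrib)
    ultimately have "(2 ^ d) ^ 3 * (2 :: real) ^ d = 16 ^ d" by simp
    then show ?thesis by simp
  qed
  also have "\<dots> \<le> 33280 ^ d * (real \<Delta> ^ 8 * ?L ^ 2) / ?q"
  proof (intro divide_right_mono mult_right_mono)
    \<comment> \<open>33280 is 2080 times 16, and \<open>d \<ge> 1\<close> lets 2080 grow to
      \<open>2080 ^ d\<close>.\<close>
    have "(2080 :: real) * 16 ^ d \<le> 2080 ^ d * 16 ^ d"
      using assms(1) power_increasing[of 1 d "2080 :: real"] by simp
    then show "2080 * 16 ^ d \<le> (33280 :: real) ^ d" by (simp flip: power_mult_distrib)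
  qed (use q in auto)
  also have "\<dots> \<le> real n * ?q / ?q" using big q by (intro divide_right_mono) auto
  also have "\<dots> = real n"
    by (rule nonzero_mult_div_cancel_right) (use q in linarith)
  finally have "(T + 1) * (2 * s) * ?b \<le> n" by (simp only: of_nat_le_iff)
  then have "(T + 1) * (2 * s) \<le> M"
    unfolding M_def using b by (subst less_eq_div_iff_mult_less_eq) auto
  moreover have "M * ?b \<le> n" unfolding M_def by (rule div_times_less_eq_dividend)
  moreover have "real n * (1 - 1 / real ?c) ^ T < 1"
    using c n T(1) by (intro stages_exhaust) auto
  moreover have "?q * real s \<ge> real (d + 4) * ?L" using s(2) q by (simp add: pos_divide_le_eq mult.commute)
  ultimately show ?thesis
    using s(1) by (intro exI[of _ M] exI[of _ T] exI[of _ s] conjI) (assumption | simp)+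
qed

lemma prob_universal_ge:
  fixes p :: real
  assumes "d \<ge> 1" "\<Delta> > 1" "0 \<le> p" "p \<le> 1" and L: "ln (real n) \<ge> 1" and n: "n \<ge> 1"
    and p: "p \<ge> 33280 * (real \<Delta> ^ 12 * real n powr (- 1 / real d) * ln (real n) ^ 3)"
  shows "measure_pmf.prob (random_graph n p) {G. universal G (graph_family n \<Delta> (real d) 7)}
    \<ge> 1 - 3 / real n"
proof -
  obtain M T s where par: "s \<ge> 1" "(T + 1) * (2 * s) \<le> M"
    "M * ((d + 1) ^ 2 * (\<Delta> + 1) ^ 6) \<le> n"
    "real n * (1 - 1 / real (2 * (d + 1) * (\<Delta> + 1) ^ 2)) ^ T < 1"
    "p ^ d * real s \<ge> real (d + 4) * ln (real n)"
    using parameters_exist[OF assms] by (elim exE conjE)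
  have "d * M + Suc T * (2 * s) \<le> (d + 1) * M" using par(2) by simp
  also have "(d + 1) * M \<le> M * ((d + 1) ^ 2 * (\<Delta> + 1) ^ 6)"
  proof -
    have "(d + 1) * M * 1 \<le> (d + 1) * M * ((d + 1) * (\<Delta> + 1) ^ 6)"
      by (rule mult_le_mono2) (simp add: Suc_le_eq)
    also have "\<dots> = M * ((d + 1) ^ 2 * (\<Delta> + 1) ^ 6)" by (simp only: power2_eq_square mult_ac)
    finally show ?thesis by simp
  qed
  finally have fit: "d * M + Suc T * (2 * s) \<le> n" using par(3) by linarith
  have "1 * (2 * s) \<le> (T + 1) * (2 * s)" by (rule mult_le_mono1) simp
  then have "2 * s \<le> M" using par(2) by linarith
  then have "1 - 3 / real n \<le>
    measure_pmf.prob (random_graph n p) {G. pseudorandom n d M T s (edges G)}"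
    using assms(1,3,4) par fit by (intro prob_pseudorandom)
  also have "\<dots> \<le> measure_pmf.prob (random_graph n p)
      {G. universal G (graph_family n \<Delta> (real d) 7)}"
  \<comment> \<open>The vertex set of \<open>G\<close> is known only on the support of the random
    graph, hence the almost sure form of monotonicity.\<close>
  proof (rule measure_pmf.finite_measure_mono_AE)
    show "AE G in measure_pmf (random_graph n p). G \<in> {G. pseudorandom n d M T s (edges G)} \<longrightarrow>
        G \<in> {G. universal G (graph_family n \<Delta> (real d) 7)}"
    proof (rule AE_pmfI, intro impI)
      fix G assume "G \<in> set_pmf (random_graph n p)"
        and G: "G \<in> {G. pseudorandom n d M T s (edges G)}"
      then have "verts G = {..<n}" by (auto simp: random_graph_def)
      then show "G \<in> {G. universal G (graph_family n \<Delta> (real d) 7)}"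
        using universal_if_pseudorandom[of G n d M T s \<Delta>] G par assms(1) n by blast
    qed
  qed simp
  finally show ?thesis .
qed

theorem theorem1p2:
  fixes d \<Delta> :: "nat \<Rightarrow> nat" and p :: "nat \<Rightarrow> real"
  assumes "\<And>n. n \<ge> 1 \<Longrightarrow> d n \<ge> 1"
    and "\<And>n. n \<ge> 1 \<Longrightarrow> \<Delta> n > 1"
    and "\<And>n. n \<ge> 1 \<Longrightarrow> 0 \<le> p n \<and> p n \<le> 1"
    and "filterlim (\<lambda>n. p n / (real (\<Delta> n) ^ 12 * real n powr (- 1 / real (d n)) * ln (real n) ^ 3))
           at_top sequentially"
  shows "(\<lambda>n. measure_pmf.prob (random_graph n (p n))
                {G. universal G (graph_family n (\<Delta> n) (real (d n)) 7)}) \<longlonglongrightarrow> 1"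
proof (rule tendsto_sandwich)
  \<comment> \<open>The diverging ratio eventually exceeds the constant of the parameter
    choice.\<close>
  have "\<forall>\<^sub>F n in sequentially. 33280 \<le>
      p n / (real (\<Delta> n) ^ 12 * real n powr (- 1 / real (d n)) * ln (real n) ^ 3)"
    using assms(4) by (simp add: filterlim_at_top)
  then show "\<forall>\<^sub>F n in sequentially. 1 - 3 / real n \<le> measure_pmf.prob (random_graph n (p n))
                {G. universal G (graph_family n (\<Delta> n) (real (d n)) 7)}"
    using eventually_ge_at_top[of 3]
  proof eventually_elim
    case (elim n)
    have n: "n \<ge> 1" using elim(2) by simp
    \<comment> \<open>The cutoff 3 for \<open>n\<close> is there to make log n at least 1.\<close>
    have "exp 1 \<le> (3 :: real)" by (rule exp_le)
    then have L: "ln (real n) \<ge> 1" using elim(2) by (subst ln_ge_iff) auto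
    have "real (\<Delta> n) ^ 12 * real n powr (- 1 / real (d n)) * ln (real n) ^ 3 > 0"
      using assms(2)[OF n] elim(2) L by (intro mult_pos_pos zero_less_power) simp_all
    then have "p n \<ge> 33280 * (real (\<Delta> n) ^ 12 * real n powr (- 1 / real (d n)) * ln (real n) ^ 3)"
      using elim(1) by (simp only: pos_le_divide_eq)
    then show ?case
      using assms(1-3)[OF n] L n by (intro prob_universal_ge) auto
  qed
  show "(\<lambda>n. 1 - 3 / real n) \<longlonglongrightarrow> 1"
    using tendsto_diff[OF tendsto_const lim_const_over_n[of 3]] by simp
qed auto

end
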